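(* Let $n\ge 1$, let $\mathcal{P}$ be a facet-bipartite $n$-polytope, and let $k$ be a positive even integer. Let $\tilde{\varphi}$ (for $\varphi\in\Gamma(\mathcal{P})$), $\alpha$ and $\beta$ be the automorphisms of the $(n+1)$-polytope $\mathcal{P}|k$ defined in the context. 1. $\mathcal{P}|k$ is hereditary. 2. $\Gamma(\mathcal{P}|k) \cong \Gamma(\mathcal{P}) \ltimes \langle \alpha, \beta \rangle$, where $\langle\alpha,\beta\rangle$ is the normal factor and $\Gamma(\mathcal{P})$ is identified with the subgroup $\{\tilde{\varphi} : \varphi\in\Gamma(\mathcal{P})\}$. 3. The symmetry type graph of $\mathcal{P}|k$ is obtained from the symmetry type graph of $\mathcal{P}$ by adding a semi-edge labeled $n$ at each node. In particular, $\mathcal{P}|k$ is regular if and only if $\mathcal{P}$ is regular.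
   Context: For an integer $n\ge 1$, an $n$-pre-maniplex is an $n$-regular simple graph (its nodes are called flags) whose edges are colored with $0,1,\ldots,n-1$ so that each flag is incident to exactly one edge of each color; $\Phi^i$ denotes the other endpoint of the edge of color $i$ at the flag $\Phi$. An $n$-maniplex is a connected $n$-pre-maniplex in which $(\Phi^i)^j=(\Phi^j)^i$ for every flag $\Phi$ and all colors $i,j$ with $|i-j|>1$. An $n$-polytope (identified with its flag graph) is an $n$-maniplex satisfying the Path Intersection Property: for every pair of flags $\Phi,\Psi$ and all colors $i\le j$, if there is a path from $\Phi$ to $\Psi$ using only colors in $\{i,\ldots,n-1\}$ and another path from $\Phi$ to $\Psi$ using only colors in $\{0,\ldots,j\}$, then there is a path from $\Phi$ to $\Psi$ using only colors in $\{i,\ldots,j\}$. The $i$-faces of an $n$-maniplex are the connected components of the graph obtained by deleting all edges of color $i$; the $(n-1)$-faces are called facets. The facet graph of an $n$-polytope $\mathcal{P}$ is the simple graph whose nodes are the facets of $\mathcal{P}$, two nodes being adjacent if there is an edge of color $n-1$ in $\mathcal{P}$ between the corresponding facets. $\mathcal{P}$ is facet-bipartite if its facet graph is bipartite. An automorphism of a polytope is a color-preserving graph automorphism; automorphisms act on the right, and $\Gamma(\mathcal{P})$ is the automorphism group. A polytope is regular if its automorphism group is transitive on flags. The symmetry type graph of a polytope $\mathcal{P}$ is the quotient of its flag graph by the flag orbits of $\Gamma(\mathcal{P})$: its nodes are the orbits, and for each color $c$ the orbit of $\Phi$ is joined by an edge of color $c$ to the orbit of $\Phi^c$, this being a semi-edge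 if the two orbits coincide. A polytope is hereditary if every automorphism of each of its facets (a facet of an $(n+1)$-polytope being regarded as a graph with edge colors $0,\ldots,n-1$) extends to an automorphism of the whole polytope; for $\mathcal{P}|k$ (whose facets are all copies of $\mathcal{P}$) this says that every automorphism of $\mathcal{P}$ lifts to an automorphism of $\mathcal{P}|k$. Construction of $\mathcal{P}|k$: properly color the facet graph of $\mathcal{P}$ with red and blue, and color each flag by the color of the facet containing it. Take $k$ disjoint copies $\mathcal{P}_1,\ldots,\mathcal{P}_k$ of $\mathcal{P}$ (the layers), and write $\Phi_i$ for the copy in $\mathcal{P}_i$ of the flag $\Phi$ of $\mathcal{P}$; subscripts are taken modulo $k$. Keep all edges of colors $0,\ldots,n-1$ inside the layers, and add edges of color $n$ as follows: for each red flag $\Phi$, join $\Phi_1$ to $\Phi_2$, $\Phi_3$ to $\Phi_4$, ..., $\Phi_{k-1}$ to $\Phi_k$; for each blue flag $\Psi$, join $\Psi_2$ to $\Psi_3$, $\Psi_4$ to $\Psi_5$, ..., $\Psi_k$ to $\Psi_1$. The resulting edge-colored graph $\mathcal{P}|k$ is (the flag graph of) an $(n+1)$-polytope whose facets are the $k$ layers. Automorphisms of $\mathcal{P}|k$: every $\varphi\in\Gamma(\mathcal{P})$ either preserves the color of every flag or reverses the color of every flag. If $\varphi$ preserves colors, $\tilde{\varphi}$ is defined by $(\Lambda_i)\tilde{\varphi}=(\Lambda\varphi)_i$; if $\varphi$ reverses colors, $\tilde{\varphi}$ is defined by $(\Lambda_i)\tilde{\varphi}=(\Lambda\varphi)_{k+2-i}$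 (for all flags $\Lambda$ of $\mathcal{P}$ and all $i$). Also $\alpha$ sends each $\Lambda_i$ to $\Lambda_{k+3-i}$ and $\beta$ sends each $\Lambda_i$ to $\Lambda_{k+5-i}$. All subscripts are modulo $k$. *)

theory Defs
  imports "HOL-Algebra.Group_Action" "HOL-Algebra.Generated_Groups"
begin

section \<open>Edge-coloured graphs\<close>

text \<open>
  An edge is a pair of its colour and its set of endpoints. An edge with two endpoints is
  an ordinary edge, an edge whose set of endpoints is a singleton is a semi-edge.
\<close>

record 'a cgraph =
  nodes :: "'a set"
  edges :: "(nat \<times> 'a set) set"

definition path_using :: "'a cgraph \<Rightarrow> nat set \<Rightarrow> 'a \<Rightarrow> 'a \<Rightarrow> bool" where
  "path_using G C \<Phi> \<Psi> \<longleftrightarrow> (\<lambda>x y. \<exists>c\<in>C. (c, {x, y}) \<in> edges G)\<^sup>*\<^sup>* \<Phi> \<Psi>"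

definition connected_cgraph :: "'a cgraph \<Rightarrow> bool" where
  "connected_cgraph G \<longleftrightarrow>
     nodes G \<noteq> {} \<and> (\<forall>\<Phi>\<in>nodes G. \<forall>\<Psi>\<in>nodes G. path_using G UNIV \<Phi> \<Psi>)"

definition induced_subgraph :: "'a cgraph \<Rightarrow> 'a set \<Rightarrow> 'a cgraph" where
  "induced_subgraph G X = \<lparr>nodes = X, edges = {(c, e) \<in> edges G. e \<subseteq> X}\<rparr>"

definition component_at :: "'a cgraph \<Rightarrow> 'a \<Rightarrow> 'a cgraph" where
  "component_at G \<Phi> = induced_subgraph G {\<Psi> \<in> nodes G. path_using G UNIV \<Phi> \<Psi>}"

definition delete_color :: "nat \<Rightarrow> 'a cgraph \<Rightarrow> 'a cgraph" where
  "delete_color i G = \<lparr>nodes = nodes G, edges = {(c, e) \<in> edges G. c \<noteq> i}\<rparr>"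

definition cgraph_iso :: "'a cgraph \<Rightarrow> 'b cgraph \<Rightarrow> ('a \<Rightarrow> 'b) set" where
  "cgraph_iso G H =
     {f. bij_betw f (nodes G) (nodes H) \<and>
         (\<forall>c. \<forall>u\<in>nodes G. \<forall>v\<in>nodes G. (c, {u, v}) \<in> edges G \<longleftrightarrow> (c, {f u, f v}) \<in> edges H)}"

definition isomorphic_cgraphs :: "'a cgraph \<Rightarrow> 'b cgraph \<Rightarrow> bool" where
  "isomorphic_cgraphs G H \<longleftrightarrow> (\<exists>f. f \<in> cgraph_iso G H)"

text \<open>
  Automorphisms act on the right: the product of \<open>f\<close> and \<open>g\<close> is \<open>f\<close> followed by \<open>g\<close>.
  As in \<^const>\<open>Bij\<close>, automorphisms are extensional functions, so that equality
  of automorphisms is equality on the nodes.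
\<close>

definition Aut :: "'a cgraph \<Rightarrow> ('a \<Rightarrow> 'a) monoid" where
  "Aut G =
     \<lparr>carrier = extensional (nodes G) \<inter> cgraph_iso G G,
      mult = (\<lambda>f g. compose (nodes G) g f),
      one = (\<lambda>x\<in>nodes G. x)\<rparr>"


section \<open>Maniplexes and polytopes\<close>

text \<open>
  The first conjunct excludes loops and semi-edges, the second excludes parallel edges. That the
  graph is \<open>n\<close>-regular is implied by all three together.
\<close>

definition pre_maniplex :: "nat \<Rightarrow> 'a cgraph \<Rightarrow> bool" where
  "pre_maniplex n G \<longleftrightarrow>
     (\<forall>(c, e)\<in>edges G. c < n \<and> e \<subseteq> nodes G \<and> card e = 2) \<and>
     (\<forall>c d e. (c, e) \<in> edges G \<and> (d, e) \<in> edges G \<longrightarrow> c = d) \<and>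
     (\<forall>\<Phi>\<in>nodes G. \<forall>c<n. \<exists>!e. (c, e) \<in> edges G \<and> \<Phi> \<in> e)"

definition nbr :: "'a cgraph \<Rightarrow> nat \<Rightarrow> 'a \<Rightarrow> 'a" where
  "nbr G i \<Phi> = (THE \<Psi>. (i, {\<Phi>, \<Psi>}) \<in> edges G)"

definition maniplex :: "nat \<Rightarrow> 'a cgraph \<Rightarrow> bool" where
  "maniplex n G \<longleftrightarrow>
     pre_maniplex n G \<and> connected_cgraph G \<and>
     (\<forall>\<Phi>\<in>nodes G. \<forall>i<n. \<forall>j<n. \<bar>int i - int j\<bar> > 1 \<longrightarrow>
        nbr G j (nbr G i \<Phi>) = nbr G i (nbr G j \<Phi>))"

definition path_intersection_property :: "nat \<Rightarrow> 'a cgraph \<Rightarrow> bool" where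
  "path_intersection_property n G \<longleftrightarrow>
     (\<forall>\<Phi>\<in>nodes G. \<forall>\<Psi>\<in>nodes G. \<forall>i j. i \<le> j \<and> j < n \<and>
        path_using G {i..<n} \<Phi> \<Psi> \<and> path_using G {0..j} \<Phi> \<Psi> \<longrightarrow> path_using G {i..j} \<Phi> \<Psi>)"

definition polytope :: "nat \<Rightarrow> 'a cgraph \<Rightarrow> bool" where
  "polytope n G \<longleftrightarrow> maniplex n G \<and> path_intersection_property n G"

definition face_at :: "nat \<Rightarrow> 'a cgraph \<Rightarrow> 'a \<Rightarrow> 'a cgraph" where
  "face_at i G \<Phi> = component_at (delete_color i G) \<Phi>"

definition faces :: "nat \<Rightarrow> 'a cgraph \<Rightarrow> 'a cgraph set" where
  "faces i G = face_at i G ` nodes G"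

definition facets :: "nat \<Rightarrow> 'a cgraph \<Rightarrow> 'a cgraph set" where
  "facets n G = faces (n - 1) G"

text \<open>The facet graph is simple: no facet is adjacent to itself.\<close>

definition facet_adjacent :: "nat \<Rightarrow> 'a cgraph \<Rightarrow> 'a cgraph \<Rightarrow> 'a cgraph \<Rightarrow> bool" where
  "facet_adjacent n G F F' \<longleftrightarrow>
     F \<in> facets n G \<and> F' \<in> facets n G \<and> F \<noteq> F' \<and>
     (\<exists>\<Phi>\<in>nodes F. \<exists>\<Psi>\<in>nodes F'. (n - 1, {\<Phi>, \<Psi>}) \<in> edges G)"

datatype red_blue = Red | Blue

definition proper_facet_coloring :: "nat \<Rightarrow> 'a cgraph \<Rightarrow> ('a cgraph \<Rightarrow> red_blue) \<Rightarrow> bool" where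
  "proper_facet_coloring n G col \<longleftrightarrow> (\<forall>F F'. facet_adjacent n G F F' \<longrightarrow> col F \<noteq> col F')"

definition facet_bipartite :: "nat \<Rightarrow> 'a cgraph \<Rightarrow> bool" where
  "facet_bipartite n G \<longleftrightarrow> (\<exists>col. proper_facet_coloring n G col)"

definition regular :: "'a cgraph \<Rightarrow> bool" where
  "regular G \<longleftrightarrow> (\<forall>\<Phi>\<in>nodes G. \<forall>\<Psi>\<in>nodes G. \<exists>g\<in>carrier (Aut G). g \<Phi> = \<Psi>)"

definition hereditary :: "nat \<Rightarrow> 'a cgraph \<Rightarrow> bool" where
  "hereditary n G \<longleftrightarrow>
     (\<forall>F\<in>facets n G. \<forall>f\<in>carrier (Aut F). \<exists>g\<in>carrier (Aut G). \<forall>\<Phi>\<in>nodes F. g \<Phi> = f \<Phi>)"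

abbreviation flag_orbit :: "'a cgraph \<Rightarrow> 'a \<Rightarrow> 'a set" where
  "flag_orbit G \<equiv> orbit (Aut G) (\<lambda>g. g)"

definition symmetry_type_graph :: "nat \<Rightarrow> 'a cgraph \<Rightarrow> 'a set cgraph" where
  "symmetry_type_graph n G =
     \<lparr>nodes = orbits (Aut G) (nodes G) (\<lambda>g. g),
      edges = {(c, {flag_orbit G \<Phi>, flag_orbit G (nbr G c \<Phi>)}) | c \<Phi>. c < n \<and> \<Phi> \<in> nodes G}\<rparr>"

definition add_semi_edges :: "nat \<Rightarrow> 'a cgraph \<Rightarrow> 'a cgraph" where
  "add_semi_edges c G = \<lparr>nodes = nodes G, edges = edges G \<union> {(c, {v}) | v. v \<in> nodes G}\<rparr>"


section \<open>The construction of layered polytopes\<close>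

text \<open>
  \<open>copy k \<Phi> i\<close> is the copy \<open>\<Phi>\<^sub>i\<close>, with the subscript read modulo \<open>k\<close>. The layer \<open>k\<close> is therefore
  represented by the residue \<open>0\<close>.
\<close>

definition copy :: "nat \<Rightarrow> 'a \<Rightarrow> int \<Rightarrow> 'a \<times> int" where
  "copy k \<Phi> i = (\<Phi>, i mod int k)"

definition flag_color :: "nat \<Rightarrow> 'a cgraph \<Rightarrow> ('a cgraph \<Rightarrow> red_blue) \<Rightarrow> 'a \<Rightarrow> red_blue" where
  "flag_color n P col \<Phi> = col (face_at (n - 1) P \<Phi>)"

text \<open>\<open>layered n P col k\<close> is the polytope \<open>P|k\<close> built from the colouring \<open>col\<close> of the facets of \<open>P\<close>.\<close>

definition layered ::
    "nat \<Rightarrow> 'a cgraph \<Rightarrow> ('a cgraph \<Rightarrow> red_blue) \<Rightarrow> nat \<Rightarrow> ('a \<times> int) cgraph" where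
  "layered n P col k =
     \<lparr>nodes = {copy k \<Phi> i | \<Phi> i. \<Phi> \<in> nodes P \<and> i \<in> {1..int k}},
      edges =
        {(c, (\<lambda>\<Phi>. copy k \<Phi> i) ` e) | c e i. (c, e) \<in> edges P \<and> i \<in> {1..int k}} \<union>
        {(n, {copy k \<Phi> i, copy k \<Phi> (i + 1)}) | \<Phi> i.
           \<Phi> \<in> nodes P \<and> flag_color n P col \<Phi> = Red \<and> i \<in> {1..int k} \<and> odd i} \<union>
        {(n, {copy k \<Phi> i, copy k \<Phi> (i + 1)}) | \<Phi> i.
           \<Phi> \<in> nodes P \<and> flag_color n P col \<Phi> = Blue \<and> i \<in> {1..int k} \<and> even i}\<rparr>"

definition preserves_colors ::
    "nat \<Rightarrow> 'a cgraph \<Rightarrow> ('a cgraph \<Rightarrow> red_blue) \<Rightarrow> ('a \<Rightarrow> 'a) \<Rightarrow> bool" where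
  "preserves_colors n P col \<phi> \<longleftrightarrow>
     (\<forall>\<Phi>\<in>nodes P. flag_color n P col (\<phi> \<Phi>) = flag_color n P col \<Phi>)"

definition lift_aut ::
    "nat \<Rightarrow> 'a cgraph \<Rightarrow> ('a cgraph \<Rightarrow> red_blue) \<Rightarrow> nat \<Rightarrow> ('a \<Rightarrow> 'a) \<Rightarrow> ('a \<times> int \<Rightarrow> 'a \<times> int)" where
  "lift_aut n P col k \<phi> =
     (\<lambda>(\<Lambda>, i)\<in>nodes (layered n P col k).
        if preserves_colors n P col \<phi> then copy k (\<phi> \<Lambda>) i else copy k (\<phi> \<Lambda>) (int k + 2 - i))"

definition layer_alpha ::
    "nat \<Rightarrow> 'a cgraph \<Rightarrow> ('a cgraph \<Rightarrow> red_blue) \<Rightarrow> nat \<Rightarrow> ('a \<times> int \<Rightarrow> 'a \<times> int)" where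
  "layer_alpha n P col k = (\<lambda>(\<Lambda>, i)\<in>nodes (layered n P col k). copy k \<Lambda> (int k + 3 - i))"

definition layer_beta ::
    "nat \<Rightarrow> 'a cgraph \<Rightarrow> ('a cgraph \<Rightarrow> red_blue) \<Rightarrow> nat \<Rightarrow> ('a \<times> int \<Rightarrow> 'a \<times> int)" where
  "layer_beta n P col k = (\<lambda>(\<Lambda>, i)\<in>nodes (layered n P col k). copy k \<Lambda> (int k + 5 - i))"


section \<open>Semidirect products\<close>

text \<open>
  The semidirect product of \<open>H\<close> with normal factor \<open>N\<close>, for a right action \<open>\<theta>\<close> of \<open>H\<close> on \<open>N\<close>;
  the pair \<open>(h, a)\<close> stands for the product \<open>h a\<close>, where \<open>a h = h (\<theta> h a)\<close>.
\<close>

definition semidirect_product ::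
    "('h, 'x) monoid_scheme \<Rightarrow> ('n, 'y) monoid_scheme \<Rightarrow> ('h \<Rightarrow> 'n \<Rightarrow> 'n) \<Rightarrow> ('h \<times> 'n) monoid" where
  "semidirect_product H N \<theta> =
     \<lparr>carrier = carrier H \<times> carrier N,
      mult = (\<lambda>(h, a) (h', a'). (h \<otimes>\<^bsub>H\<^esub> h', \<theta> h' a \<otimes>\<^bsub>N\<^esub> a')),
      one = (\<one>\<^bsub>H\<^esub>, \<one>\<^bsub>N\<^esub>)\<rparr>"

end

(*
  An automorphism of P|k permutes the layers, and since it preserves adjacency of layers it acts on
  their indices by i |-> s i + t with s = 1 or s = -1, and on the flags of P by a single automorphism
  phi. As the edges of colour n are governed by the parity of i and the colour of the flag, s and phi
  determine the parity of t, and every such choice does give an automorphism. Forgetting s and t is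
  a homomorphism onto the automorphism group of P which is split by the lifts; its kernel consists
  of the maps i |-> i + t (t even) and i |-> t - i (t odd), and these are generated by alpha and
  beta. For any prescribed layers i and j and any phi there is such a map sending i to j, which
  shows that P|k is hereditary and that the flag orbits do not depend on the layer.
*)

theory Submission
  imports Defs
begin

section \<open>Split extensions\<close>

text \<open>The form s i + t is not found by following an automorphism from layer to layer. Flag
  graphs are handled as families of fixed-point-free involutions \<open>nbr G c\<close>, and an
  automorphism of a connected one is determined by the image of a single flag. So only the image of
  layer 0 is examined, which yields \<phi> and t; s is then chosen by parity, and agreement at one
  flag settles the rest. The triple (\<phi>, s, t) is a description and not an invariant: t matters
  only modulo k, and s is invisible when k = 2. Parity of a layer index makes sense because k is
  even. The colour of a flag must switch along every edge of colour n - 1, but a proper colouring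
  constrains only pairs of distinct facets. One therefore has to know that no such edge joins a
  facet to itself, and this is extracted from the path intersection property of P.\<close>

lemma split_extension:
  assumes "group G" "group H" and p: "p \<in> hom G H" and l: "l \<in> hom H G"
    and pl: "\<forall>h\<in>carrier H. p (l h) = h"
  shows "kernel G H p \<lhd> G"
    and "subgroup (l ` carrier H) G"
    and "l \<in> iso H (G\<lparr>carrier := l ` carrier H\<rparr>)"
    and "(\<lambda>(h, a). l h \<otimes>\<^bsub>G\<^esub> a) \<in>
      iso (semidirect_product H (G\<lparr>carrier := kernel G H p\<rparr>)
             (\<lambda>h a. inv\<^bsub>G\<^esub> (l h) \<otimes>\<^bsub>G\<^esub> a \<otimes>\<^bsub>G\<^esub> l h)) G"
proof -
  interpret G: group G by fact
  interpret H: group H by fact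
  interpret p: group_hom G H p using p by unfold_locales
  interpret l: group_hom H G l using l by unfold_locales
  show "kernel G H p \<lhd> G" by (rule p.normal_kernel)
  show "subgroup (l ` carrier H) G" by (rule l.img_is_subgroup)
  have inj: "inj_on l (carrier H)" by (metis inj_onI pl)
  show "l \<in> iso H (G\<lparr>carrier := l ` carrier H\<rparr>)"
    using inj by (auto simp: iso_def hom_def bij_betw_def)
  let ?K = "kernel G H p"
  let ?S = "semidirect_product H (G\<lparr>carrier := ?K\<rparr>) (\<lambda>h a. inv\<^bsub>G\<^esub> (l h) \<otimes>\<^bsub>G\<^esub> a \<otimes>\<^bsub>G\<^esub> l h)"
  let ?f = "\<lambda>(h, a). l h \<otimes>\<^bsub>G\<^esub> a"
  have K: "a \<in> ?K \<longleftrightarrow> a \<in> carrier G \<and> p a = \<one>\<^bsub>H\<^esub>" for a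
    by (simp add: kernel_def)
  have carr: "carrier ?S = carrier H \<times> ?K"
    by (simp add: semidirect_product_def)
  have "?f \<in> hom ?S G"
  proof (rule homI)
    fix x y assume "x \<in> carrier ?S" "y \<in> carrier ?S"
    then obtain h a h' a' where xy: "x = (h, a)" "y = (h', a')"
      and mem: "h \<in> carrier H" "a \<in> carrier G" "h' \<in> carrier H" "a' \<in> carrier G"
      by (auto simp: carr K)
    \<comment> \<open>Cancelling \<open>l h'\<close> against its inverse gives h a h' a' = (h h')
      (h'^-1 a h') a', where the conjugate of a is the action in the semidirect product.\<close>
    have "l h' \<otimes>\<^bsub>G\<^esub> (inv\<^bsub>G\<^esub> (l h') \<otimes>\<^bsub>G\<^esub> z) = z" if "z \<in> carrier G" for z
      using that mem by (simp flip: G.m_assoc)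
    then have "l h \<otimes>\<^bsub>G\<^esub> l h' \<otimes>\<^bsub>G\<^esub> (inv\<^bsub>G\<^esub> (l h') \<otimes>\<^bsub>G\<^esub> a \<otimes>\<^bsub>G\<^esub> l h' \<otimes>\<^bsub>G\<^esub> a')
        = l h \<otimes>\<^bsub>G\<^esub> a \<otimes>\<^bsub>G\<^esub> (l h' \<otimes>\<^bsub>G\<^esub> a')"
      using mem by (simp add: G.m_assoc)
    then show "?f (x \<otimes>\<^bsub>?S\<^esub> y) = ?f x \<otimes>\<^bsub>G\<^esub> ?f y"
      using mem by (simp add: xy semidirect_product_def)
  qed (auto simp: carr K)
  moreover have "bij_betw ?f (carrier ?S) (carrier G)"
  \<comment> \<open>The \<open>H\<close>-part of \<open>g\<close> is \<open>p g\<close>; dividing by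
    its lift on the left leaves an element of the kernel, because \<open>p\<close> undoes
    \<open>l\<close>.\<close>
  proof (rule bij_betwI[where g = "\<lambda>g. (p g, inv\<^bsub>G\<^esub> (l (p g)) \<otimes>\<^bsub>G\<^esub> g)"])
    show "?f \<in> carrier ?S \<rightarrow> carrier G"
      by (auto simp: carr K)
    show "(\<lambda>g. (p g, inv\<^bsub>G\<^esub> (l (p g)) \<otimes>\<^bsub>G\<^esub> g)) \<in> carrier G \<rightarrow> carrier ?S"
      by (auto simp: carr K pl)
    show "(\<lambda>g. (p g, inv\<^bsub>G\<^esub> (l (p g)) \<otimes>\<^bsub>G\<^esub> g)) (?f x) = x" if "x \<in> carrier ?S" for x
      using that by (auto simp: carr K pl simp flip: G.m_assoc)
    show "?f ((\<lambda>g. (p g, inv\<^bsub>G\<^esub> (l (p g)) \<otimes>\<^bsub>G\<^esub> g)) g) = g" if "g \<in> carrier G" for g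
      using that by (simp flip: G.m_assoc)
  qed
  ultimately show "?f \<in> iso ?S G"
    by (simp add: iso_def)
qed

section \<open>Automorphism groups of edge-coloured graphs\<close>

lemma mem_Aut_iff:
  "f \<in> carrier (Aut G) \<longleftrightarrow> f \<in> extensional (nodes G) \<and> bij_betw f (nodes G) (nodes G) \<and>
     (\<forall>c. \<forall>u\<in>nodes G. \<forall>v\<in>nodes G. (c, {u, v}) \<in> edges G \<longleftrightarrow> (c, {f u, f v}) \<in> edges G)"
  by (simp add: Aut_def cgraph_iso_def)

lemma mult_Aut: "f \<otimes>\<^bsub>Aut G\<^esub> g = compose (nodes G) g f"
  and one_Aut: "\<one>\<^bsub>Aut G\<^esub> = (\<lambda>x\<in>nodes G. x)"
  by (simp_all add: Aut_def)

lemma Aut_closed: "f \<in> carrier (Aut G) \<Longrightarrow> x \<in> nodes G \<Longrightarrow> f x \<in> nodes G"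
  by (auto simp: mem_Aut_iff bij_betw_def)

lemma group_Aut: "group (Aut G)"
proof (rule groupI)
  fix f assume f: "f \<in> carrier (Aut G)"
  let ?g = "\<lambda>x\<in>nodes G. inv_into (nodes G) f x"
  have bij: "bij_betw f (nodes G) (nodes G)" using f by (simp add: mem_Aut_iff)
  have bij_g: "bij_betw ?g (nodes G) (nodes G)"
    using bij_betw_inv_into[OF bij] by (subst bij_betw_cong[where g = "inv_into (nodes G) f"]) auto
  have inv: "?g x \<in> nodes G \<and> f (?g x) = x" if "x \<in> nodes G" for x
    using that bij_betw_apply[OF bij_g that] bij_betw_inv_into_right[OF bij that] by simp
  have "(c, {u, v}) \<in> edges G \<longleftrightarrow> (c, {?g u, ?g v}) \<in> edges G" if "u \<in> nodes G" "v \<in> nodes G" for c u v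
    using f inv[OF that(1)] inv[OF that(2)] unfolding mem_Aut_iff by metis
  then have "?g \<in> carrier (Aut G)"
    using bij_g by (simp add: mem_Aut_iff)
  moreover have "?g \<otimes>\<^bsub>Aut G\<^esub> f = \<one>\<^bsub>Aut G\<^esub>"
    using inv by (auto simp: mult_Aut one_Aut compose_def fun_eq_iff)
  ultimately show "\<exists>g\<in>carrier (Aut G). g \<otimes>\<^bsub>Aut G\<^esub> f = \<one>\<^bsub>Aut G\<^esub>" by blast
next
  fix f g assume fg: "f \<in> carrier (Aut G)" "g \<in> carrier (Aut G)"
  then have "bij_betw (compose (nodes G) g f) (nodes G) (nodes G)"
    using bij_betw_compose mem_Aut_iff by metis
  moreover have "(c, {u, v}) \<in> edges G \<longleftrightarrow> (c, {g (f u), g (f v)}) \<in> edges G"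
    if "u \<in> nodes G" "v \<in> nodes G" for c u v
    using fg that Aut_closed[OF fg(1)] unfolding mem_Aut_iff by metis
  ultimately show "f \<otimes>\<^bsub>Aut G\<^esub> g \<in> carrier (Aut G)"
    by (simp add: mem_Aut_iff mult_Aut compose_eq)
next
  fix f g h assume "f \<in> carrier (Aut G)" "g \<in> carrier (Aut G)" "h \<in> carrier (Aut G)"
  then show "f \<otimes>\<^bsub>Aut G\<^esub> g \<otimes>\<^bsub>Aut G\<^esub> h = f \<otimes>\<^bsub>Aut G\<^esub> (g \<otimes>\<^bsub>Aut G\<^esub> h)"
    by (auto simp: mult_Aut compose_def fun_eq_iff dest: Aut_closed)
next
  show "\<one>\<^bsub>Aut G\<^esub> \<in> carrier (Aut G)"
    by (auto simp: mem_Aut_iff one_Aut bij_betw_def inj_on_def)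
next
  fix f assume "f \<in> carrier (Aut G)"
  then show "\<one>\<^bsub>Aut G\<^esub> \<otimes>\<^bsub>Aut G\<^esub> f = f"
    by (auto simp: mult_Aut one_Aut compose_def fun_eq_iff mem_Aut_iff extensional_def)
qed

lemma orbit_Aut: "flag_orbit G x = {g x |g. g \<in> carrier (Aut G)}"
  by (simp add: orbit_def)

lemma mem_flag_orbit_refl: "x \<in> nodes G \<Longrightarrow> x \<in> flag_orbit G x"
  using monoid.one_closed[OF group.is_monoid[OF group_Aut[of G]]] by (force simp: orbit_Aut one_Aut intro!: exI[of _ "\<one>\<^bsub>Aut G\<^esub>"])

lemma flag_orbit_eq:
  assumes "g \<in> carrier (Aut G)" "x \<in> nodes G"
  shows "flag_orbit G (g x) = flag_orbit G x"
proof -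
  interpret group "Aut G" by (rule group_Aut)
  have sub: "flag_orbit G (g x) \<subseteq> flag_orbit G x" if "g \<in> carrier (Aut G)" "x \<in> nodes G" for g x
  proof
    fix y assume "y \<in> flag_orbit G (g x)"
    then obtain h where h: "h \<in> carrier (Aut G)" "y = h (g x)" by (auto simp: orbit_Aut)
    then have "y = (g \<otimes>\<^bsub>Aut G\<^esub> h) x" using that by (simp add: mult_Aut compose_eq)
    then show "y \<in> flag_orbit G x" using h(1) that(1) unfolding orbit_Aut by blast
  qed
  have "inv\<^bsub>Aut G\<^esub> g \<in> carrier (Aut G)" using assms by simp
  moreover have "(inv\<^bsub>Aut G\<^esub> g) (g x) = x"
    using fun_cong[OF r_inv[OF assms(1)], of x] assms(2) by (simp add: mult_Aut one_Aut compose_eq)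
  ultimately show ?thesis
    using sub[OF assms] sub[of "inv\<^bsub>Aut G\<^esub> g" "g x"] Aut_closed[OF assms] by auto
qed

lemma flag_orbit_eq_iff:
  assumes "x \<in> nodes G" "y \<in> nodes G"
  shows "flag_orbit G x = flag_orbit G y \<longleftrightarrow> (\<exists>g\<in>carrier (Aut G). g x = y)"
proof
  assume "flag_orbit G x = flag_orbit G y"
  then have "y \<in> flag_orbit G x" using mem_flag_orbit_refl[OF assms(2)] by simp
  then show "\<exists>g\<in>carrier (Aut G). g x = y" by (auto simp: orbit_Aut)
qed (use flag_orbit_eq[OF _ assms(1)] in blast)

lemma nodes_symmetry_type_graph: "nodes (symmetry_type_graph n G) = flag_orbit G ` nodes G"
  by (auto simp: symmetry_type_graph_def orbits_def)

lemma mem_edges_symmetry_type_graph: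
  "(c, e) \<in> edges (symmetry_type_graph n G) \<longleftrightarrow>
     c < n \<and> (\<exists>x\<in>nodes G. e = {flag_orbit G x, flag_orbit G (nbr G c x)})"
  by (auto simp: symmetry_type_graph_def)

section \<open>Pre-maniplexes\<close>

text \<open>A flag lies on exactly one edge of each colour, and that edge has two endpoints, so the
  \<open>THE\<close> in \<open>nbr\<close> is well defined. This trades sets of edges for
  functions.\<close>

lemma edge_iff_nbr:
  assumes "pre_maniplex n G"
  shows "(c, {x, y}) \<in> edges G \<longleftrightarrow> c < n \<and> x \<in> nodes G \<and> y = nbr G c x"
proof -
  have *: "(c, {x, y}) \<in> edges G \<longleftrightarrow> y = nbr G c x" if cx: "c < n" "x \<in> nodes G" for y
  proof -
    obtain e where e: "(c, e) \<in> edges G" "x \<in> e" and uniq: "\<And>e'. (c, e') \<in> edges G \<Longrightarrow> x \<in> e' \<Longrightarrow> e' = e"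
      using assms cx unfolding pre_maniplex_def by metis
    have "card e = 2" using assms e(1) unfolding pre_maniplex_def by fast
    then obtain z where z: "e = {x, z}" "z \<noteq> x"
      using e(2) by (auto simp: card_2_iff)
    have iff: "(c, {x, y}) \<in> edges G \<longleftrightarrow> y = z" for y
      using uniq[of "{x, y}"] e(1) z by (metis doubleton_eq_iff insertI1)
    then show ?thesis by (simp add: nbr_def)
  qed
  moreover have "c < n \<and> x \<in> nodes G" if "(c, {x, y}) \<in> edges G"
    using assms that unfolding pre_maniplex_def by fast
  ultimately show ?thesis by blast
qed

lemma
  assumes "pre_maniplex n G" "x \<in> nodes G" "c < n"
  shows nbr_closed: "nbr G c x \<in> nodes G"
    and nbr_neq: "nbr G c x \<noteq> x"
    and nbr_nbr: "nbr G c (nbr G c x) = x"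
    and nbr_inject: "d < n \<Longrightarrow> nbr G c x = nbr G d x \<Longrightarrow> c = d"
proof -
  have e: "(c, {x, nbr G c x}) \<in> edges G" using assms by (simp add: edge_iff_nbr)
  then have "{x, nbr G c x} \<subseteq> nodes G \<and> card {x, nbr G c x} = 2"
    using assms(1) unfolding pre_maniplex_def by fast
  then show "nbr G c x \<in> nodes G" "nbr G c x \<noteq> x" by auto
  show "nbr G c (nbr G c x) = x"
    using e by (metis insert_commute assms(1) edge_iff_nbr)
  show "c = d" if "d < n" "nbr G c x = nbr G d x"
  proof -
    have "(d, {x, nbr G c x}) \<in> edges G" using assms that by (simp add: edge_iff_nbr)
    with e show ?thesis using assms(1) unfolding pre_maniplex_def by blast
  qed
qed

text \<open>A converse: fixed-point-free involutions, no two of which agree at a node, are the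
  neighbour functions of a pre-maniplex. The involution property lets an edge be recovered from
  either endpoint, and \<open>inj\<close> excludes parallel edges.\<close>

lemma
  assumes edges: "\<And>c e. (c, e) \<in> edges G \<longleftrightarrow> c < n \<and> (\<exists>x\<in>nodes G. e = {x, r c x})"
    and r: "\<And>c x. c < n \<Longrightarrow> x \<in> nodes G \<Longrightarrow> r c x \<in> nodes G \<and> r c x \<noteq> x \<and> r c (r c x) = x"
    and inj: "\<And>c d x. c < n \<Longrightarrow> d < n \<Longrightarrow> x \<in> nodes G \<Longrightarrow> r c x = r d x \<Longrightarrow> c = d"
  shows pre_maniplexI: "pre_maniplex n G"
    and nbr_eqI: "c < n \<Longrightarrow> x \<in> nodes G \<Longrightarrow> nbr G c x = r c x"
proof -
  have e: "e = {x, r c x}" if "(c, e) \<in> edges G" "x \<in> e" for c e x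
    using that r by (auto simp: edges)
  have ex: "\<exists>!e. (c, e) \<in> edges G \<and> x \<in> e" if "x \<in> nodes G" "c < n" for c x
    using that e edges[of c "{x, r c x}"] by (intro ex1I[of _ "{x, r c x}"]) blast+
  have two: "c < n \<and> e \<subseteq> nodes G \<and> card e = 2" if ce: "(c, e) \<in> edges G" for c e
  proof -
    obtain x where x: "c < n" "x \<in> nodes G" "e = {x, r c x}"
      using iffD1[OF edges ce] by auto
    then show ?thesis using r[OF x(1,2)] by (simp add: card_2_iff')
  qed
  have one: "c = d" if ce: "(c, e) \<in> edges G" and de: "(d, e) \<in> edges G" for c d e
  proof -
    obtain x where x: "x \<in> nodes G" "e = {x, r c x}"
      using iffD1[OF edges ce] by auto
    then have "{x, r c x} = {x, r d x}" using e[OF de, of x] by simp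
    then have "r c x = r d x" by (auto simp: doubleton_eq_iff)
    then show ?thesis using inj[OF _ _ x(1)] iffD1[OF edges ce] iffD1[OF edges de] by auto
  qed
  show pm: "pre_maniplex n G"
    using ex two one unfolding pre_maniplex_def by blast
  show "nbr G c x = r c x" if "c < n" "x \<in> nodes G"
    using edge_iff_nbr[OF pm, of c x "r c x"] edges[of c "{x, r c x}"] that by auto
qed

text \<open>Uniqueness of the neighbour of each colour turns preservation of edges into commuting
  with \<open>nbr\<close>; that edges are also reflected comes from injectivity of
  \<open>f\<close>.\<close>

lemma mem_Aut_iff_nbr:
  assumes "pre_maniplex n G"
  shows "f \<in> carrier (Aut G) \<longleftrightarrow> f \<in> extensional (nodes G) \<and> bij_betw f (nodes G) (nodes G) \<and>
     (\<forall>c<n. \<forall>x\<in>nodes G. f (nbr G c x) = nbr G c (f x))"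
proof (cases "bij_betw f (nodes G) (nodes G)")
  case True
  then have "f u = f v \<longleftrightarrow> u = v" "f u \<in> nodes G" if "u \<in> nodes G" "v \<in> nodes G" for u v
    using that by (auto simp: bij_betw_def inj_on_def)
  then show ?thesis
    using True nbr_closed[OF assms] unfolding mem_Aut_iff edge_iff_nbr[OF assms] by metis
qed (simp add: mem_Aut_iff)

section \<open>Paths, connectedness and rigidity of automorphisms\<close>

lemma path_using_refl: "path_using G C x x"
  by (simp add: path_using_def)

lemma path_using_trans: "path_using G C x y \<Longrightarrow> path_using G C y z \<Longrightarrow> path_using G C x z"
  by (simp add: path_using_def)

lemma path_using_sym: "path_using G C x y \<Longrightarrow> path_using G C y x"
  unfolding path_using_def
  by (rule sympD[OF symp_rtranclp]) (auto simp: symp_def insert_commute)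

lemma path_using_nbr:
  assumes "pre_maniplex n G" "x \<in> nodes G" "c \<in> C" "c < n"
  shows "path_using G C x (nbr G c x)"
  unfolding path_using_def using assms by (intro r_into_rtranclp) (auto simp: edge_iff_nbr)

lemma path_using_induct:
  assumes "pre_maniplex n G" "path_using G C x y" "x \<in> nodes G" "R x"
    and step: "\<And>y c. y \<in> nodes G \<Longrightarrow> c \<in> C \<Longrightarrow> c < n \<Longrightarrow> R y \<Longrightarrow> R (nbr G c y)"
  shows "y \<in> nodes G \<and> R y"
  using assms(2) unfolding path_using_def
proof (induction rule: rtranclp_induct)
  case base
  then show ?case using assms by simp
next
  case (step y z)
  then show ?case using assms(1,5) by (auto simp: edge_iff_nbr nbr_closed)
qed

lemma connected_induct:
  assumes "pre_maniplex n G" "connected_cgraph G" "x \<in> nodes G" "R x"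
    and "\<And>y c. y \<in> nodes G \<Longrightarrow> c < n \<Longrightarrow> R y \<Longrightarrow> R (nbr G c y)" and "y \<in> nodes G"
  shows "R y"
proof -
  have "path_using G UNIV x y" using assms(2,3,6) by (simp add: connected_cgraph_def)
  from assms(1) this assms(3,4) have "y \<in> nodes G \<and> R y"
    by (rule path_using_induct) (rule assms(5))
  then show ?thesis ..
qed

text \<open>Both maps commute with \<open>nbr\<close>, so agreement passes from a flag to its
  neighbours and, by connectedness, to all flags.\<close>

lemma Aut_eqI:
  assumes "pre_maniplex n G" "connected_cgraph G" "f \<in> carrier (Aut G)" "g \<in> carrier (Aut G)"
    and "x \<in> nodes G" "f x = g x"
  shows "f = g"
proof (rule extensionalityI)
  show "f \<in> extensional (nodes G)" "g \<in> extensional (nodes G)"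
    using assms by (simp_all add: mem_Aut_iff)
  show "f y = g y" if "y \<in> nodes G" for y
    using assms(1,2,5,6) _ that
    by (rule connected_induct[where R = "\<lambda>y. f y = g y"])
       (use assms in \<open>simp add: mem_Aut_iff_nbr\<close>)
qed

section \<open>Faces\<close>

lemma path_using_delete_color: "path_using (delete_color i G) C = path_using G (C - {i})"
proof -
  have "(\<lambda>x y. \<exists>c\<in>C. (c, {x, y}) \<in> edges (delete_color i G)) = (\<lambda>x y. \<exists>c\<in>C - {i}. (c, {x, y}) \<in> edges G)"
    by (auto simp: delete_color_def fun_eq_iff)
  then show ?thesis by (simp add: path_using_def fun_eq_iff)
qed

lemma nodes_face_at: "nodes (face_at i G x) = {y \<in> nodes G. path_using G (- {i}) x y}"
  by (simp add: face_at_def component_at_def induced_subgraph_def path_using_delete_color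
      Compl_eq_Diff_UNIV) (simp add: delete_color_def)

lemma edges_face_at:
  "edges (face_at i G x) = {(c, e) \<in> edges G. c \<noteq> i \<and> e \<subseteq> nodes (face_at i G x)}"
  by (auto simp: face_at_def component_at_def induced_subgraph_def delete_color_def)

lemma face_at_eqI: "nodes (face_at i G x) = nodes (face_at i G y) \<Longrightarrow> face_at i G x = face_at i G y"
  using edges_face_at[of i G x] edges_face_at[of i G y] by (intro cgraph.equality) simp_all

lemma face_at_nbr:
  assumes "pre_maniplex n G" "x \<in> nodes G" "c < n" "c \<noteq> i"
  shows "face_at i G (nbr G c x) = face_at i G x"
proof (rule face_at_eqI)
  have "path_using G (- {i}) x (nbr G c x)"
    using assms by (intro path_using_nbr) auto
  then have "path_using G (- {i}) (nbr G c x) y \<longleftrightarrow> path_using G (- {i}) x y" for y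
    by (meson path_using_trans path_using_sym)
  then show "nodes (face_at i G (nbr G c x)) = nodes (face_at i G x)"
    by (simp add: nodes_face_at)
qed

text \<open>
  The case \<open>i = n - 1\<close>, \<open>j = n - 2\<close> of the path intersection property is not part of its
  definition, which requires \<open>i \<le> j\<close>; it is recovered from the case \<open>i = j = n - 2\<close>.
\<close>

lemma face_at_nbr_neq:
  assumes "polytope n G" "n \<ge> 1" "x \<in> nodes G"
  shows "face_at (n - 1) G (nbr G (n - 1) x) \<noteq> face_at (n - 1) G x"
proof
  let ?y = "nbr G (n - 1) x"
  have pm: "pre_maniplex n G" and pip: "path_intersection_property n G"
    using assms(1) by (simp_all add: polytope_def maniplex_def)
  have y: "?y \<in> nodes G" "?y \<noteq> x"
    using assms nbr_closed[OF pm] nbr_neq[OF pm] by simp_all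
  assume "face_at (n - 1) G ?y = face_at (n - 1) G x"
  moreover have "?y \<in> nodes (face_at (n - 1) G ?y)"
    using y by (simp add: nodes_face_at path_using_refl)
  ultimately have "path_using G (- {n - 1}) x ?y"
    by (simp add: nodes_face_at)
  \<comment> \<open>The half-open interval matters: for \<open>n = 1\<close> it is empty, whereas
    \<open>{0..n - 2}\<close> would be \<open>{0}\<close> by truncated subtraction.\<close>
  from pm this assms(3) have "?y \<in> nodes G \<and> path_using G {0..<n - 1} x ?y"
  proof (rule path_using_induct)
    fix y c assume *: "y \<in> nodes G" "c \<in> - {n - 1}" "c < n" "path_using G {0..<n - 1} x y"
    then have "path_using G {0..<n - 1} y (nbr G c y)"
      by (intro path_using_nbr[OF pm]) auto
    then show "path_using G {0..<n - 1} x (nbr G c y)"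
      by (rule path_using_trans[OF *(4)])
  qed (rule path_using_refl)
  then have p: "path_using G {0..<n - 1} x ?y" ..
  show False
  proof (cases "n = 1")
    case True
    then show False using path_using_induct[OF pm p assms(3), of "\<lambda>z. z = x"] y by simp
  next
    case False
    then have n: "n \<ge> 2" using assms by simp
    then have "{0..<n - 1} = {0..n - 2}" by auto
    then have "path_using G {0..n - 2} x ?y" using p by simp
    moreover have "path_using G {n - 2..<n} x ?y"
      using n assms by (intro path_using_nbr[OF pm]) auto
    ultimately have "path_using G {n - 2..n - 2} x ?y"
      using pip[unfolded path_intersection_property_def, rule_format, of x ?y "n - 2" "n - 2"]
        assms(3) y n by simp
    \<comment> \<open>A walk in the single colour \<open>n - 2\<close> oscillates between
      \<open>x\<close> and one neighbour. So \<open>?y\<close> would be the neighbour of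
      \<open>x\<close> in two different colours.\<close>
    from pm this assms(3) have "?y \<in> nodes G \<and> (?y = x \<or> ?y = nbr G (n - 2) x)"
    proof (rule path_using_induct)
      show "nbr G c y = x \<or> nbr G c y = nbr G (n - 2) x"
        if "c \<in> {n - 2..n - 2}" "y = x \<or> y = nbr G (n - 2) x" for c y
        using that n assms nbr_nbr[OF pm] by auto
    qed simp
    then have "n - 1 = n - 2"
      using y n assms nbr_inject[OF pm, of x "n - 1" "n - 2"] by auto
    then show False using n by simp
  qed
qed

lemma mem_edges_iff:
  assumes "pre_maniplex n G"
  shows "(c, e) \<in> edges G \<longleftrightarrow> c < n \<and> (\<exists>x\<in>nodes G. e = {x, nbr G c x})"
proof
  assume ce: "(c, e) \<in> edges G"
  then have "card e = 2" using assms unfolding pre_maniplex_def by fast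
  then obtain x y where "e = {x, y}" by (auto simp: card_2_iff)
  then show "c < n \<and> (\<exists>x\<in>nodes G. e = {x, nbr G c x})"
    using ce by (auto simp: edge_iff_nbr[OF assms])
qed (auto simp: edge_iff_nbr[OF assms])

section \<open>The layered polytope\<close>

locale layering =
  fixes n k :: nat and P :: "'a cgraph" and col :: "'a cgraph \<Rightarrow> red_blue"
  assumes n_pos: "n \<ge> 1" and polytope_P: "polytope n P"
    and coloring: "proper_facet_coloring n P col"
    and k_pos: "k > 0" and k_even: "even k"
begin

abbreviation "Q \<equiv> layered n P col k"
abbreviation "red \<Lambda> \<equiv> flag_color n P col \<Lambda> = Red"

lemma pm: "pre_maniplex n P" and conn: "connected_cgraph P" and pip: "path_intersection_property n P"
  using polytope_P by (simp_all add: polytope_def maniplex_def)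

lemmas nbr_P = nbr_closed[OF pm] nbr_neq[OF pm] nbr_nbr[OF pm]

text \<open>Edges of the other colours stay inside a facet. For colour \<open>n - 1\<close> the two
  facets are distinct by \<open>face_at_nbr_neq\<close>, which is needed before properness of the
  colouring says anything.\<close>

lemma red_nbr:
  assumes "\<Lambda> \<in> nodes P" "c < n"
  shows "red (nbr P c \<Lambda>) \<longleftrightarrow> (red \<Lambda> \<longleftrightarrow> c \<noteq> n - 1)"
proof (cases "c = n - 1")
  case True
  have mem: "\<Phi> \<in> nodes (face_at (n - 1) P \<Phi>)" if "\<Phi> \<in> nodes P" for \<Phi>
    using that by (simp add: nodes_face_at path_using_refl)
  have "facet_adjacent n P (face_at (n - 1) P \<Lambda>) (face_at (n - 1) P (nbr P c \<Lambda>))"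
    unfolding facet_adjacent_def facets_def faces_def
  proof (intro conjI bexI)
    show "(n - 1, {\<Lambda>, nbr P c \<Lambda>}) \<in> edges P"
      using assms True by (simp add: edge_iff_nbr[OF pm])
  qed (use assms True mem nbr_P face_at_nbr_neq[OF polytope_P n_pos assms(1)] in auto)
  then have "flag_color n P col \<Lambda> \<noteq> flag_color n P col (nbr P c \<Lambda>)"
    using coloring by (simp add: proper_facet_coloring_def flag_color_def)
  then show ?thesis
    using True by (cases "flag_color n P col \<Lambda>"; cases "flag_color n P col (nbr P c \<Lambda>)") auto
qed (use assms face_at_nbr[OF pm] in \<open>simp add: flag_color_def\<close>)

section \<open>Subscripts modulo \<open>k\<close>\<close>

lemma copy_eq_iff: "copy k \<Phi> i = copy k \<Psi> j \<longleftrightarrow> \<Phi> = \<Psi> \<and> int k dvd i - j"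
  by (simp add: copy_def mod_eq_dvd_iff)

lemma even_int_k: "even (int k)"
  using k_even by simp

lemma even_if_copy_eq: "copy k \<Phi> i = copy k \<Psi> j \<Longrightarrow> even i \<longleftrightarrow> even j"
  using dvd_trans[OF even_int_k, of "i - j"] by (simp add: copy_eq_iff)

lemma copy_fst_snd: "copy k (fst (copy k \<Phi> i)) (snd (copy k \<Phi> i)) = copy k \<Phi> i"
  by (simp add: copy_def)

lemma fst_copy [simp]: "fst (copy k \<Phi> i) = \<Phi>"
  and snd_copy [simp]: "snd (copy k \<Phi> i) = i mod int k"
  by (simp_all add: copy_def)

text \<open>\<open>layered\<close> uses only subscripts in \<open>{1..int k}\<close>; this
  representative frees later arguments from that range. The shift by 1 yields \<open>int k\<close>
  instead of 0, and since the successor is congruent to \<open>i + 1\<close>, the edges from layer k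
  back to layer 1 need no separate case.\<close>

lemma copy_index:
  obtains j where "j \<in> {1..int k}" "\<And>\<Phi>::'a. copy k \<Phi> j = copy k \<Phi> i"
    "\<And>\<Phi>::'a. copy k \<Phi> (j + 1) = copy k \<Phi> (i + 1)" "odd j \<longleftrightarrow> odd i"
proof
  let ?j = "(i - 1) mod int k + 1"
  have "int k dvd (i - 1) mod int k - (i - 1)"
    by (simp add: mod_eq_dvd_iff[symmetric])
  then have d: "int k dvd ?j - i" "int k dvd (?j + 1) - (i + 1)"
    by (simp_all add: algebra_simps)
  show "?j \<in> {1..int k}"
    using k_pos by (simp add: add1_zle_eq)
  show "copy k \<Phi> ?j = copy k \<Phi> i" "copy k \<Phi> (?j + 1) = copy k \<Phi> (i + 1)" for \<Phi> :: 'a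
    using d by (simp_all only: copy_eq_iff simp_thms)
  show "odd ?j \<longleftrightarrow> odd i"
    using dvd_trans[OF even_int_k d(1)] by (simp only: even_diff even_add)
qed

lemma nodes_Q: "nodes Q = {copy k \<Phi> i | \<Phi> i. \<Phi> \<in> nodes P}"
proof -
  have "copy k \<Phi> i \<in> nodes Q" if "\<Phi> \<in> nodes P" for \<Phi> i
  proof -
    obtain j where j: "j \<in> {1..int k}" "copy k \<Phi> j = copy k \<Phi> i"
      using copy_index[of i] by metis
    have "copy k \<Phi> j \<in> nodes Q"
      using that j(1) by (auto simp: layered_def)
    then show ?thesis using j(2) by simp
  qed
  then show ?thesis by (auto simp: layered_def)
qed

lemma copy_mem_Q [simp]: "copy k \<Phi> i \<in> nodes Q \<longleftrightarrow> \<Phi> \<in> nodes P"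
proof
  assume "copy k \<Phi> i \<in> nodes Q"
  then obtain \<Psi> j where "copy k \<Phi> i = copy k \<Psi> j" "\<Psi> \<in> nodes P"
    by (auto simp only: nodes_Q mem_Collect_eq)
  then show "\<Phi> \<in> nodes P" by (simp add: copy_eq_iff)
next
  assume "\<Phi> \<in> nodes P"
  then show "copy k \<Phi> i \<in> nodes Q" unfolding nodes_Q by blast
qed

lemma nodes_Q_cases:
  assumes "x \<in> nodes Q"
  obtains \<Phi> i where "x = copy k \<Phi> i" "\<Phi> \<in> nodes P"
  using assms by (auto simp only: nodes_Q mem_Collect_eq)

lemma bex_nodes_Q: "(\<exists>x\<in>nodes Q. R x) \<longleftrightarrow> (\<exists>\<Phi> i. \<Phi> \<in> nodes P \<and> R (copy k \<Phi> i))"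
  by (metis copy_mem_Q nodes_Q_cases)

text \<open>The edge of colour \<open>n\<close> at a flag goes up one layer for red flags in odd
  layers and blue flags in even layers, and down otherwise.\<close>

definition dir :: "'a \<Rightarrow> int \<Rightarrow> int" where
  "dir \<Phi> i = (if red \<Phi> \<longleftrightarrow> odd i then 1 else - 1)"

lemma dir_cases: "dir \<Phi> i = 1 \<or> dir \<Phi> i = - 1"
  by (simp add: dir_def)

text \<open>Candidate for the neighbour function of \<open>P|k\<close>, to be fed into
  \<open>pre_maniplexI\<close> and \<open>nbr_eqI\<close> as \<open>r\<close>.\<close>

definition step :: "nat \<Rightarrow> 'a \<times> int \<Rightarrow> 'a \<times> int" where
  "step c = (\<lambda>(\<Phi>, i). if c < n then copy k (nbr P c \<Phi>) i else copy k \<Phi> (i + dir \<Phi> i))"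

lemma step_copy:
  "step c (copy k \<Phi> i) = (if c < n then copy k (nbr P c \<Phi>) i else copy k \<Phi> (i + dir \<Phi> i))"
proof -
  have "even (i mod int k) \<longleftrightarrow> even i"
    using even_if_copy_eq[of undefined "i mod int k" undefined i] by (simp add: copy_def)
  then have "dir \<Phi> (i mod int k) = dir \<Phi> i"
    by (simp add: dir_def)
  then show ?thesis
    by (simp add: step_def copy_def mod_simps)
qed

lemma mem_edges_Q_iff:
  "(c, e) \<in> edges Q \<longleftrightarrow>
     (\<exists>e' i. (c, e') \<in> edges P \<and> e = (\<lambda>\<Phi>. copy k \<Phi> i) ` e') \<or>
     c = n \<and> (\<exists>\<Phi> i. \<Phi> \<in> nodes P \<and> (red \<Phi> \<longleftrightarrow> odd i) \<and> e = {copy k \<Phi> i, copy k \<Phi> (i + 1)})"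
    (is "_ \<longleftrightarrow> ?R")
proof
  assume "(c, e) \<in> edges Q"
  then consider e' i where "(c, e') \<in> edges P" "e = (\<lambda>\<Phi>. copy k \<Phi> i) ` e'"
    | \<Phi> i where "c = n" "\<Phi> \<in> nodes P" "flag_color n P col \<Phi> = Red" "odd i"
        "e = {copy k \<Phi> i, copy k \<Phi> (i + 1)}"
    | \<Phi> i where "c = n" "\<Phi> \<in> nodes P" "flag_color n P col \<Phi> = Blue" "even i"
        "e = {copy k \<Phi> i, copy k \<Phi> (i + 1)}"
    unfolding layered_def by simp blast
  then show ?R
    by cases (blast, blast, metis red_blue.distinct(1))
next
  have not_red: "flag_color n P col \<Phi> = Blue" if "\<not> red \<Phi>" for \<Phi>
    using that by (cases "flag_color n P col \<Phi>") auto
  assume ?R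
  then show "(c, e) \<in> edges Q"
  proof (elim disjE exE conjE)
    fix e' i assume e: "(c, e') \<in> edges P" "e = (\<lambda>\<Phi>. copy k \<Phi> i) ` e'"
    obtain j where j: "j \<in> {1..int k}" "\<And>\<Phi>::'a. copy k \<Phi> j = copy k \<Phi> i"
      using copy_index[of i] by metis
    have "e = (\<lambda>\<Phi>. copy k \<Phi> j) ` e'" by (simp add: e(2) j(2))
    then show ?thesis using e j(1) by (auto simp: layered_def)
  next
    fix \<Phi> i assume e: "c = n" "\<Phi> \<in> nodes P" "red \<Phi> \<longleftrightarrow> odd i" "e = {copy k \<Phi> i, copy k \<Phi> (i + 1)}"
    obtain j where j: "j \<in> {1..int k}" "\<And>\<Phi>::'a. copy k \<Phi> j = copy k \<Phi> i"
      "\<And>\<Phi>::'a. copy k \<Phi> (j + 1) = copy k \<Phi> (i + 1)" "odd j \<longleftrightarrow> odd i"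
      using copy_index[of i] by metis
    have "e = {copy k \<Phi> j, copy k \<Phi> (j + 1)}" using e j by simp
    then show ?thesis using e(1-3) j(1,4) not_red[of \<Phi>] by (cases "odd i") (auto simp: layered_def)
  qed
qed

lemma edges_Q: "(c, e) \<in> edges Q \<longleftrightarrow> c < n + 1 \<and> (\<exists>x\<in>nodes Q. e = {x, step c x})"
proof (cases "c < n")
  case True
  have "(\<exists>e' i. (c, e') \<in> edges P \<and> e = (\<lambda>\<Phi>. copy k \<Phi> i) ` e') \<longleftrightarrow>
      (\<exists>\<Phi> i. \<Phi> \<in> nodes P \<and> e = {copy k \<Phi> i, copy k (nbr P c \<Phi>) i})"
    using True by (simp add: mem_edges_iff[OF pm]) blast
  also have "\<dots> \<longleftrightarrow> (\<exists>x\<in>nodes Q. e = {x, step c x})"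
    using True by (simp add: bex_nodes_Q step_copy)
  finally show ?thesis using True by (simp add: mem_edges_Q_iff)
next
  case False
  then have P: "(c, e') \<notin> edges P" for e' by (simp add: mem_edges_iff[OF pm])
  have "(\<exists>\<Phi> i. \<Phi> \<in> nodes P \<and> (red \<Phi> \<longleftrightarrow> odd i) \<and> e = {copy k \<Phi> i, copy k \<Phi> (i + 1)}) \<longleftrightarrow>
      (\<exists>\<Phi> i. \<Phi> \<in> nodes P \<and> e = {copy k \<Phi> i, copy k \<Phi> (i + dir \<Phi> i)})" (is "?L \<longleftrightarrow> ?R")
  proof
    assume ?L
    then obtain \<Phi> i where e: "\<Phi> \<in> nodes P" "red \<Phi> \<longleftrightarrow> odd i" "e = {copy k \<Phi> i, copy k \<Phi> (i + 1)}"
      by blast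
    then have "e = {copy k \<Phi> i, copy k \<Phi> (i + dir \<Phi> i)}" by (simp add: dir_def)
    then show ?R using e(1) by blast
  next
    assume ?R
    then obtain \<Phi> i where e: "\<Phi> \<in> nodes P" "e = {copy k \<Phi> i, copy k \<Phi> (i + dir \<Phi> i)}" by blast
    show ?L
    proof (cases "red \<Phi> \<longleftrightarrow> odd i")
      case True
      then have "e = {copy k \<Phi> i, copy k \<Phi> (i + 1)}" using e by (simp add: dir_def)
      then show ?thesis using e(1) True by blast
    next
      case False
      \<comment> \<open>Here the edge goes down from layer \<open>i\<close>, so it is the upward
        edge at layer \<open>i - 1\<close>, whose parity is opposite.\<close>
      then have "(red \<Phi> \<longleftrightarrow> odd (i - 1)) \<and> e = {copy k \<Phi> (i - 1), copy k \<Phi> (i - 1 + 1)}"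
        using e(2) by (auto simp: dir_def)
      then show ?thesis using e(1) by blast
    qed
  qed
  also have "\<dots> \<longleftrightarrow> (\<exists>x\<in>nodes Q. e = {x, step c x})"
    using False by (simp add: bex_nodes_Q step_copy)
  finally show ?thesis using False P by (auto simp: mem_edges_Q_iff)
qed

text \<open>An even number cannot divide 1 or -1. This excludes loops of colour \<open>n\<close>,
  even when \<open>k = 2\<close>.\<close>

lemma not_k_dvd_dir: "\<not> int k dvd dir \<Phi> i"
  using dvd_trans[OF even_int_k, of "dir \<Phi> i"] dir_cases[of \<Phi> i] by auto

lemma dir_dir: "dir \<Phi> (i + dir \<Phi> i) = - dir \<Phi> i"
  by (auto simp: dir_def)

lemma step_properties:
  assumes "c < n + 1" "x \<in> nodes Q"
  shows "step c x \<in> nodes Q \<and> step c x \<noteq> x \<and> step c (step c x) = x"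
proof -
  obtain \<Phi> i where "x = copy k \<Phi> i" "\<Phi> \<in> nodes P"
    using assms(2) by (rule nodes_Q_cases)
  then show ?thesis
    using not_k_dvd_dir[of \<Phi> i] by (simp add: step_copy nbr_P copy_eq_iff dir_dir)
qed

lemma step_inject:
  assumes "c < n + 1" "d < n + 1" "x \<in> nodes Q" "step c x = step d x"
  shows "c = d"
proof -
  obtain \<Phi> i where "x = copy k \<Phi> i" "\<Phi> \<in> nodes P"
    using assms(3) by (rule nodes_Q_cases)
  then show ?thesis
    using assms nbr_inject[OF pm, of \<Phi> c d] nbr_P(2)[of \<Phi> c] nbr_P(2)[of \<Phi> d]
    by (auto simp: step_copy copy_eq_iff less_Suc_eq split: if_splits)
qed

lemma pm_Q: "pre_maniplex (n + 1) Q"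
  using edges_Q step_properties step_inject by (rule pre_maniplexI[where r = step])

lemma nbr_Q: "c < n + 1 \<Longrightarrow> x \<in> nodes Q \<Longrightarrow> nbr Q c x = step c x"
  using edges_Q step_properties step_inject by (rule nbr_eqI[where r = step])

lemma
  assumes "\<Phi> \<in> nodes P"
  shows nbr_Q_less: "c < n \<Longrightarrow> nbr Q c (copy k \<Phi> i) = copy k (nbr P c \<Phi>) i"
    and nbr_Q_n: "nbr Q n (copy k \<Phi> i) = copy k \<Phi> (i + dir \<Phi> i)"
  using assms by (simp_all add: nbr_Q step_copy)

lemma path_lift:
  assumes "path_using P C \<Phi> \<Psi>" "\<Phi> \<in> nodes P"
  shows "path_using Q C (copy k \<Phi> i) (copy k \<Psi> i)"
proof -
  from pm assms have "\<Psi> \<in> nodes P \<and> path_using Q C (copy k \<Phi> i) (copy k \<Psi> i)"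
  proof (rule path_using_induct)
    fix \<Psi> c
    assume *: "\<Psi> \<in> nodes P" "c \<in> C" "c < n" "path_using Q C (copy k \<Phi> i) (copy k \<Psi> i)"
    then have "path_using Q C (copy k \<Psi> i) (nbr Q c (copy k \<Psi> i))"
      by (intro path_using_nbr[OF pm_Q]) auto
    then show "path_using Q C (copy k \<Phi> i) (copy k (nbr P c \<Psi>) i)"
      using path_using_trans[OF *(4)] * by (simp add: nbr_Q_less)
  qed (rule path_using_refl)
  then show ?thesis ..
qed

text \<open>Edges of colour \<open>n\<close> keep the flag of \<open>P\<close> and are the only ones
  to change the layer. So erasing them projects a path to \<open>P\<close>, and a path without them
  stays in its layer.\<close>

lemma path_project:
  assumes "path_using Q C x y" "x \<in> nodes Q"
  shows "path_using P (C - {n}) (fst x) (fst y)" and "n \<notin> C \<Longrightarrow> snd y = snd x"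
proof -
  from pm_Q assms
  have "y \<in> nodes Q \<and> path_using P (C - {n}) (fst x) (fst y) \<and> (n \<notin> C \<longrightarrow> snd y = snd x)"
  proof (rule path_using_induct)
    fix y c
    assume *: "y \<in> nodes Q" "c \<in> C" "c < n + 1"
      "path_using P (C - {n}) (fst x) (fst y) \<and> (n \<notin> C \<longrightarrow> snd y = snd x)"
    obtain \<Psi> i where y: "y = copy k \<Psi> i" "\<Psi> \<in> nodes P"
      using *(1) by (rule nodes_Q_cases)
    show "path_using P (C - {n}) (fst x) (fst (nbr Q c y)) \<and> (n \<notin> C \<longrightarrow> snd (nbr Q c y) = snd x)"
    proof (cases "c = n")
      case True
      then show ?thesis using * y by (simp add: nbr_Q_n)
    next
      case False
      then have c: "c < n" "c \<in> C - {n}" using * by auto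
      then have "path_using P (C - {n}) \<Psi> (nbr P c \<Psi>)"
        using y by (intro path_using_nbr[OF pm])
      then have "path_using P (C - {n}) (fst x) (nbr P c \<Psi>)"
        using * y by (auto intro: path_using_trans[of P "C - {n}" "fst x" \<Psi>])
      moreover have "snd (nbr Q c y) = snd y"
        using y c by (simp add: nbr_Q_less)
      ultimately show ?thesis using * y c by (simp add: nbr_Q_less)
    qed
  qed (simp add: path_using_refl)
  then show "path_using P (C - {n}) (fst x) (fst y)" "n \<notin> C \<Longrightarrow> snd y = snd x" by simp_all
qed

section \<open>Connectedness, commutation of distant colours and path intersection\<close>

lemma nodes_P_nonempty: obtains \<Phi> where "\<Phi> \<in> nodes P"
  using conn by (auto simp: connected_cgraph_def)

lemma ex_red_iff: "\<exists>\<Phi>\<in>nodes P. red \<Phi> \<longleftrightarrow> b"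
proof -
  obtain \<Phi> where \<Phi>: "\<Phi> \<in> nodes P" by (rule nodes_P_nonempty)
  have "red (nbr P (n - 1) \<Phi>) \<longleftrightarrow> \<not> red \<Phi>"
    using red_nbr[OF \<Phi>, of "n - 1"] n_pos by simp
  then show ?thesis using \<Phi> nbr_P(1)[OF \<Phi>, of "n - 1"] n_pos by (cases "red \<Phi> \<longleftrightarrow> b") auto
qed

lemma path_P: "\<Phi> \<in> nodes P \<Longrightarrow> \<Psi> \<in> nodes P \<Longrightarrow> path_using P UNIV \<Phi> \<Psi>"
  using conn by (simp add: connected_cgraph_def)

text \<open>Walk inside layer \<open>i\<close> to a flag \<Psi> whose colour makes its edge of
  colour \<open>n\<close> go up, cross it, and walk back inside the next layer. Such a \<Psi> exists
  because colour \<open>n - 1\<close> switches red and blue.\<close>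

lemma path_next_layer:
  assumes "\<Phi> \<in> nodes P"
  shows "path_using Q UNIV (copy k \<Phi> i) (copy k \<Phi> (i + 1))"
proof -
  obtain \<Psi> where \<Psi>: "\<Psi> \<in> nodes P" "red \<Psi> \<longleftrightarrow> odd i"
    using ex_red_iff by blast
  have "path_using Q UNIV (copy k \<Psi> i) (nbr Q n (copy k \<Psi> i))"
    using \<Psi> by (intro path_using_nbr[OF pm_Q]) auto
  then have "path_using Q UNIV (copy k \<Psi> i) (copy k \<Psi> (i + 1))"
    using \<Psi> by (simp add: nbr_Q_n dir_def)
  then have "path_using Q UNIV (copy k \<Phi> i) (copy k \<Psi> (i + 1))"
    by (rule path_using_trans[OF path_lift[OF path_P[OF assms \<Psi>(1)] assms]])
  then show ?thesis
    by (rule path_using_trans[OF _ path_lift[OF path_P[OF \<Psi>(1) assms] \<Psi>(1)]])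
qed

lemma connected_Q: "connected_cgraph Q"
proof -
  have nat: "path_using Q UNIV (copy k \<Phi> i) (copy k \<Phi> (i + int m))" if "\<Phi> \<in> nodes P" for \<Phi> i m
  proof (induction m)
    case (Suc m)
    then show ?case
      using path_using_trans[OF Suc path_next_layer[OF that]] by (simp add: ac_simps)
  qed (simp add: path_using_refl)
  have "path_using Q UNIV x y" if xy: "x \<in> nodes Q" "y \<in> nodes Q" for x y
  proof -
    obtain \<Phi> i where x: "x = copy k \<Phi> i" "\<Phi> \<in> nodes P" using xy(1) by (rule nodes_Q_cases)
    obtain \<Psi> j where y: "y = copy k \<Psi> j" "\<Psi> \<in> nodes P" using xy(2) by (rule nodes_Q_cases)
    \<comment> \<open>The available walks only ascend, so the difference of subscripts is replaced
      by its nonnegative residue.\<close>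
    have "copy k \<Psi> (i + int (nat ((j - i) mod int k))) = copy k \<Psi> j"
      using k_pos by (simp add: copy_def mod_simps)
    then have "path_using Q UNIV (copy k \<Psi> i) y"
      using nat[OF y(2), of i "nat ((j - i) mod int k)"] y by simp
    then show ?thesis
      unfolding x(1) by (rule path_using_trans[OF path_lift[OF path_P[OF x(2) y(2)] x(2)]])
  qed
  moreover obtain \<Phi> where "\<Phi> \<in> nodes P" by (rule nodes_P_nonempty)
  then have "copy k \<Phi> 0 \<in> nodes Q" by simp
  ultimately show ?thesis unfolding connected_cgraph_def by blast
qed

text \<open>Colours below \<open>n - 1\<close> keep a flag in its facet, hence keep its colour and
  the direction of its edge of colour \<open>n\<close>.\<close>

lemma nbr_Q_n_commute:
  assumes "c < n - 1" "x \<in> nodes Q"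
  shows "nbr Q n (nbr Q c x) = nbr Q c (nbr Q n x)"
proof -
  obtain \<Phi> i where x: "x = copy k \<Phi> i" "\<Phi> \<in> nodes P"
    using assms(2) by (rule nodes_Q_cases)
  then have "dir (nbr P c \<Phi>) i = dir \<Phi> i"
    using assms(1) red_nbr[of \<Phi> c] by (simp add: dir_def)
  then show ?thesis using x assms(1) by (simp add: nbr_Q_less nbr_Q_n nbr_P)
qed

lemma maniplex_Q: "maniplex (n + 1) Q"
  unfolding maniplex_def
proof (intro conjI ballI allI impI)
  fix x i j assume *: "x \<in> nodes Q" "i < n + 1" "j < n + 1" "\<bar>int i - int j\<bar> > 1"
  obtain \<Phi> l where x: "x = copy k \<Phi> l" "\<Phi> \<in> nodes P"
    using *(1) by (rule nodes_Q_cases)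
  consider "i < n" "j < n" | "i = n" "j < n - 1" | "j = n" "i < n - 1"
    using * by linarith
  then show "nbr Q j (nbr Q i x) = nbr Q i (nbr Q j x)"
  proof cases
    case 1
    then have "nbr P j (nbr P i \<Phi>) = nbr P i (nbr P j \<Phi>)"
      using polytope_P x * by (simp add: polytope_def maniplex_def)
    then show ?thesis using 1 x by (simp add: nbr_Q_less nbr_P)
  qed (use nbr_Q_n_commute * in auto)
qed (simp_all add: pm_Q[simplified] connected_Q)

lemma polytope_Q: "polytope (n + 1) Q"
  unfolding polytope_def path_intersection_property_def
proof (intro conjI ballI allI impI maniplex_Q)
  fix x y i j
  assume xy: "x \<in> nodes Q" "y \<in> nodes Q"
    and ij: "i \<le> j \<and> j < n + 1 \<and> path_using Q {i..<n + 1} x y \<and> path_using Q {0..j} x y"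
  show "path_using Q {i..j} x y"
  proof (cases "j = n")
    case True
    then have "{i..<n + 1} = {i..j}" by auto
    then show ?thesis using ij by simp
  next
    case False
    \<comment> \<open>The second path avoids colour \<open>n\<close>, so both flags lie in one
      layer. The first path may leave that layer, but its projection to \<open>P\<close> does not
      use colour \<open>n\<close>.\<close>
    then have "{i..<n + 1} - {n} = {i..<n}" "{0..j} - {n} = {0..j}" using ij by auto
    then have "path_using P {i..<n} (fst x) (fst y)" "path_using P {0..j} (fst x) (fst y)" "snd y = snd x"
      using path_project[of "{i..<n + 1}" x y] path_project[of "{0..j}" x y] ij xy False by auto
    moreover have mem: "fst x \<in> nodes P" "fst y \<in> nodes P"
      using xy by (auto elim!: nodes_Q_cases)
    ultimately have "path_using P {i..j} (fst x) (fst y)"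
      using pip[unfolded path_intersection_property_def, rule_format, of "fst x" "fst y" i j] ij False
      by simp
    then have "path_using Q {i..j} (copy k (fst x) (snd x)) (copy k (fst y) (snd x))"
      using mem by (intro path_lift)
    moreover have "copy k (fst x) (snd x) = x" "copy k (fst y) (snd x) = y"
      using xy copy_fst_snd \<open>snd y = snd x\<close> by (metis nodes_Q_cases)+
    ultimately show ?thesis by simp
  qed
qed

section \<open>Automorphisms of the layered polytope\<close>

interpretation Aut_P: group "Aut P"
  by (rule group_Aut)

lemma Aut_nbr_P: "\<phi> \<in> carrier (Aut P) \<Longrightarrow> c < n \<Longrightarrow> \<Phi> \<in> nodes P \<Longrightarrow> \<phi> (nbr P c \<Phi>) = nbr P c (\<phi> \<Phi>)"
  by (simp add: mem_Aut_iff_nbr[OF pm])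

abbreviation "preserving \<phi> \<equiv> preserves_colors n P col \<phi>"

text \<open>Along an edge of colour \<open>n - 1\<close> the colours of a flag and of its image both
  change; along other edges neither does. So whether they agree is constant on the connected flag
  graph, and \<phi> preserves all colours or reverses all.\<close>

lemma red_Aut:
  assumes "\<phi> \<in> carrier (Aut P)" "\<Phi> \<in> nodes P"
  shows "red (\<phi> \<Phi>) \<longleftrightarrow> (red \<Phi> \<longleftrightarrow> preserving \<phi>)"
proof -
  have col: "flag_color n P col (\<phi> \<Psi>) = flag_color n P col \<Psi> \<longleftrightarrow> (red (\<phi> \<Psi>) \<longleftrightarrow> red \<Psi>)" for \<Psi>
    by (cases "flag_color n P col (\<phi> \<Psi>)"; cases "flag_color n P col \<Psi>") auto
  have "(red (\<phi> \<Psi>) \<longleftrightarrow> red \<Psi>) \<longleftrightarrow> (red (\<phi> \<Phi>) \<longleftrightarrow> red \<Phi>)" if "\<Psi> \<in> nodes P" for \<Psi>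
    using pm conn assms(2) refl _ that
  proof (rule connected_induct[where R = "\<lambda>\<Psi>. (red (\<phi> \<Psi>) \<longleftrightarrow> red \<Psi>) \<longleftrightarrow> (red (\<phi> \<Phi>) \<longleftrightarrow> red \<Phi>)"])
    fix \<Psi> c assume "\<Psi> \<in> nodes P" "c < n" "(red (\<phi> \<Psi>) \<longleftrightarrow> red \<Psi>) \<longleftrightarrow> (red (\<phi> \<Phi>) \<longleftrightarrow> red \<Phi>)"
    then show "(red (\<phi> (nbr P c \<Psi>)) \<longleftrightarrow> red (nbr P c \<Psi>)) \<longleftrightarrow> (red (\<phi> \<Phi>) \<longleftrightarrow> red \<Phi>)"
      using assms(1) by (auto simp: Aut_nbr_P red_nbr Aut_closed)
  qed
  then have "preserving \<phi> \<longleftrightarrow> (red (\<phi> \<Phi>) \<longleftrightarrow> red \<Phi>)"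
    using assms(2) unfolding preserves_colors_def col by blast
  then show ?thesis by blast
qed

lemma preserving_one: "preserving \<one>\<^bsub>Aut P\<^esub>"
  by (simp add: preserves_colors_def one_Aut)

lemma preserving_mult:
  assumes "\<phi> \<in> carrier (Aut P)" "\<psi> \<in> carrier (Aut P)"
  shows "preserving (\<phi> \<otimes>\<^bsub>Aut P\<^esub> \<psi>) \<longleftrightarrow> (preserving \<phi> \<longleftrightarrow> preserving \<psi>)"
proof -
  obtain \<Phi> where \<Phi>: "\<Phi> \<in> nodes P" by (rule nodes_P_nonempty)
  show ?thesis
    using red_Aut[OF Aut_P.m_closed[OF assms] \<Phi>]
      red_Aut[OF assms(1) \<Phi>] red_Aut[OF assms(2) Aut_closed[OF assms(1) \<Phi>]] \<Phi>
    by (auto simp: mult_Aut compose_eq)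
qed

text \<open>
  The edge of colour \<open>n\<close> at \<open>\<Phi>\<^sub>i\<close> points to the next or the previous layer according to the parity of
  \<open>i\<close> and the colour of \<open>\<Phi>\<close>: the direction is flipped by an odd \<open>t\<close> and by a colour-reversing \<open>\<phi>\<close>,
  and it must be flipped in total iff \<open>s = - 1\<close>.
\<close>

definition layer_map :: "('a \<Rightarrow> 'a) \<Rightarrow> int \<Rightarrow> int \<Rightarrow> 'a \<times> int \<Rightarrow> 'a \<times> int" where
  "layer_map \<phi> s t = (\<lambda>(\<Lambda>, i)\<in>nodes Q. copy k (\<phi> \<Lambda>) (s * i + t))"

definition compatible :: "('a \<Rightarrow> 'a) \<Rightarrow> int \<Rightarrow> int \<Rightarrow> bool" where
  "compatible \<phi> s t \<longleftrightarrow> (s = 1 \<or> s = - 1) \<and> (even t \<longleftrightarrow> (s = 1 \<longleftrightarrow> preserving \<phi>))"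

lemma layer_map_copy:
  assumes "\<Phi> \<in> nodes P"
  shows "layer_map \<phi> s t (copy k \<Phi> i) = copy k (\<phi> \<Phi>) (s * i + t)"
proof -
  have "(\<Phi>, i mod int k) \<in> nodes Q"
    using assms copy_mem_Q[of \<Phi> i] by (simp add: copy_def)
  then show ?thesis
    by (simp add: layer_map_def copy_def) (metis mod_add_left_eq mod_mult_right_eq)
qed

lemma layer_map_extensional: "layer_map \<phi> s t \<in> extensional (nodes Q)"
  by (simp add: layer_map_def)

lemma eq_layer_mapI:
  assumes "g \<in> extensional (nodes Q)"
    and "\<And>\<Phi> i. \<Phi> \<in> nodes P \<Longrightarrow> g (copy k \<Phi> i) = copy k (\<phi> \<Phi>) (s * i + t)"
  shows "g = layer_map \<phi> s t"
  using assms(1) layer_map_extensional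
proof (rule extensionalityI)
  fix x assume "x \<in> nodes Q"
  then obtain \<Phi> i where "x = copy k \<Phi> i" "\<Phi> \<in> nodes P" by (rule nodes_Q_cases)
  then show "g x = layer_map \<phi> s t x" by (simp add: assms(2) layer_map_copy)
qed

lemma lift_eq:
  "lift_aut n P col k \<phi> = (if preserving \<phi> then layer_map \<phi> 1 0 else layer_map \<phi> (- 1) (int k + 2))"
  by (auto simp: lift_aut_def layer_map_def fun_eq_iff)

lemma alpha_eq: "layer_alpha n P col k = layer_map \<one>\<^bsub>Aut P\<^esub> (- 1) (int k + 3)"
  and beta_eq: "layer_beta n P col k = layer_map \<one>\<^bsub>Aut P\<^esub> (- 1) (int k + 5)"
  by (auto simp: layer_alpha_def layer_beta_def layer_map_def layered_def fun_eq_iff restrict_def copy_def one_Aut)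

lemma mult_layer_map:
  assumes "\<phi> \<in> carrier (Aut P)"
  shows "layer_map \<phi> s t \<otimes>\<^bsub>Aut Q\<^esub> layer_map \<psi> s' t'
    = layer_map (\<phi> \<otimes>\<^bsub>Aut P\<^esub> \<psi>) (s * s') (s' * t + t')"
  using assms unfolding mult_Aut
  by (intro eq_layer_mapI) (auto simp: compose_eq layer_map_copy Aut_closed algebra_simps)

lemma layer_map_Aut:
  assumes "\<phi> \<in> carrier (Aut P)" "compatible \<phi> s t"
  shows "layer_map \<phi> s t \<in> carrier (Aut Q)"
  unfolding mem_Aut_iff_nbr[OF pm_Q]
proof (intro conjI allI impI ballI)
  have s: "s * s = 1" "s = 1 \<or> s = - 1" using assms(2) by (auto simp: compatible_def)
  have bij: "bij_betw \<phi> (nodes P) (nodes P)" using assms(1) by (simp add: mem_Aut_iff)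
  show "bij_betw (layer_map \<phi> s t) (nodes Q) (nodes Q)"
  proof (rule bij_betw_imageI)
    show "inj_on (layer_map \<phi> s t) (nodes Q)"
    proof (rule inj_onI)
      fix x y assume xy: "x \<in> nodes Q" "y \<in> nodes Q" and eq: "layer_map \<phi> s t x = layer_map \<phi> s t y"
      obtain \<Phi> i where x: "x = copy k \<Phi> i" "\<Phi> \<in> nodes P" using xy(1) by (rule nodes_Q_cases)
      obtain \<Psi> j where y: "y = copy k \<Psi> j" "\<Psi> \<in> nodes P" using xy(2) by (rule nodes_Q_cases)
      have \<phi>: "\<phi> \<Phi> = \<phi> \<Psi>" and "int k dvd s * i + t - (s * j + t)"
        using eq x y by (simp_all only: layer_map_copy copy_eq_iff)
      then have "int k dvd s * (s * i + t - (s * j + t))" by simp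
      also have "s * (s * i + t - (s * j + t)) = s * s * (i - j)" by (simp add: algebra_simps)
      finally have "int k dvd i - j" by (simp only: s(1) mult_1)
      moreover have "\<Phi> = \<Psi>"
        using bij \<phi> x(2) y(2) by (auto simp: bij_betw_def dest: inj_onD)
      ultimately show "x = y" using x y by (simp add: copy_eq_iff)
    qed
    show "layer_map \<phi> s t ` nodes Q = nodes Q"
    proof (intro equalityI subsetI)
      fix y assume "y \<in> layer_map \<phi> s t ` nodes Q"
      then show "y \<in> nodes Q"
        using Aut_closed[OF assms(1)] by (auto elim!: nodes_Q_cases simp: layer_map_copy)
    next
      fix y assume "y \<in> nodes Q"
      then obtain \<Psi> j where y: "y = copy k \<Psi> j" "\<Psi> \<in> nodes P" by (rule nodes_Q_cases)
      then obtain \<Phi> where "\<Phi> \<in> nodes P" "\<Psi> = \<phi> \<Phi>" using bij by (auto simp: bij_betw_def)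
      \<comment> \<open>The subscript solves s i + t = j, since s is its own inverse.\<close>
      moreover from this have "layer_map \<phi> s t (copy k \<Phi> (s * (j - t))) = copy k \<Psi> j"
        using s by (simp add: layer_map_copy mult.assoc[symmetric])
      ultimately show "y \<in> layer_map \<phi> s t ` nodes Q"
        unfolding y by (metis copy_mem_Q imageI)
    qed
  qed
  fix c x assume "c < n + 1" "x \<in> nodes Q"
  moreover from this obtain \<Phi> i where x: "x = copy k \<Phi> i" "\<Phi> \<in> nodes P" by (auto elim: nodes_Q_cases)
  ultimately consider "c < n" | "c = n" by linarith
  then show "layer_map \<phi> s t (nbr Q c x) = nbr Q c (layer_map \<phi> s t x)"
  proof cases
    case 1
    then show ?thesis
      using x assms(1) by (simp add: nbr_Q_less layer_map_copy nbr_P Aut_closed Aut_nbr_P)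
  next
    case 2
    have "dir (\<phi> \<Phi>) (s * i + t) = s * dir \<Phi> i"
      using assms red_Aut[OF assms(1) x(2)] s(2) by (auto simp: dir_def compatible_def)
    then show ?thesis
      using 2 x assms(1) by (simp add: nbr_Q_n layer_map_copy Aut_closed algebra_simps)
  qed
qed (rule layer_map_extensional)

lemma ex_compatible:
  obtains s where "compatible \<phi> s t"
proof -
  have "compatible \<phi> (if even t \<longleftrightarrow> preserving \<phi> then 1 else - 1) t"
    by (auto simp: compatible_def)
  then show ?thesis by (rule that)
qed

text \<open>Colours below \<open>n\<close> never leave a layer, so layer 0 is carried into a single
  layer \<open>t\<close> by some \<phi>. The sign supplied by \<open>ex_compatible\<close> has no
  effect at subscript 0, so the candidate agrees with \<open>g\<close> at a flag of layer 0, and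
  rigidity makes them equal.\<close>

lemma Aut_Q_cases:
  assumes "g \<in> carrier (Aut Q)"
  obtains \<phi> s t where "\<phi> \<in> carrier (Aut P)" "compatible \<phi> s t" "g = layer_map \<phi> s t"
proof -
  obtain \<Phi>\<^sub>0 where \<Phi>\<^sub>0: "\<Phi>\<^sub>0 \<in> nodes P" by (rule nodes_P_nonempty)
  define t where "t = snd (g (copy k \<Phi>\<^sub>0 0))"
  define \<phi> where "\<phi> = (\<lambda>\<Phi>\<in>nodes P. fst (g (copy k \<Phi> 0)))"
  have mem: "g (copy k \<Phi> 0) \<in> nodes Q" if "\<Phi> \<in> nodes P" for \<Phi>
    using Aut_closed[OF assms] that by simp
  have closed: "\<phi> \<Phi> \<in> nodes P" if "\<Phi> \<in> nodes P" for \<Phi>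
    using mem[OF that] that by (auto simp: \<phi>_def elim!: nodes_Q_cases)
  have copy: "copy k (\<phi> \<Phi>) (snd (g (copy k \<Phi> 0))) = g (copy k \<Phi> 0)" if "\<Phi> \<in> nodes P" for \<Phi>
    using mem[OF that] that copy_fst_snd by (auto simp: \<phi>_def elim!: nodes_Q_cases)
  have nbr: "g (copy k (nbr P c \<Phi>) 0) = nbr Q c (g (copy k \<Phi> 0))" if "\<Phi> \<in> nodes P" "c < n" for \<Phi> c
  proof -
    have "g (nbr Q c (copy k \<Phi> 0)) = nbr Q c (g (copy k \<Phi> 0))"
      using assms that by (simp add: mem_Aut_iff_nbr[OF pm_Q])
    then show ?thesis using that by (simp add: nbr_Q_less)
  qed
  have layer: "g (copy k \<Phi> 0) = copy k (\<phi> \<Phi>) t" if "\<Phi> \<in> nodes P" for \<Phi>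
    using pm conn \<Phi>\<^sub>0 _ _ that
  proof (rule connected_induct[where R = "\<lambda>\<Phi>. g (copy k \<Phi> 0) = copy k (\<phi> \<Phi>) t"])
    show "g (copy k \<Phi>\<^sub>0 0) = copy k (\<phi> \<Phi>\<^sub>0) t"
      using copy[OF \<Phi>\<^sub>0] by (simp add: t_def)
    fix \<Phi> c assume *: "\<Phi> \<in> nodes P" "c < n" "g (copy k \<Phi> 0) = copy k (\<phi> \<Phi>) t"
    then have g: "g (copy k (nbr P c \<Phi>) 0) = copy k (nbr P c (\<phi> \<Phi>)) t"
      using nbr closed by (simp add: nbr_Q_less)
    have "\<phi> (nbr P c \<Phi>) = fst (g (copy k (nbr P c \<Phi>) 0))"
      using *(1,2) by (simp add: \<phi>_def nbr_P)
    then show "g (copy k (nbr P c \<Phi>) 0) = copy k (\<phi> (nbr P c \<Phi>)) t"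
      unfolding g by simp
  qed
  have comm: "\<phi> (nbr P c \<Phi>) = nbr P c (\<phi> \<Phi>)" if "\<Phi> \<in> nodes P" "c < n" for \<Phi> c
    using nbr[OF that] that layer[of \<Phi>] layer[of "nbr P c \<Phi>"]
    by (simp add: nbr_P closed nbr_Q_less copy_eq_iff)
  have "bij_betw \<phi> (nodes P) (nodes P)"
  proof (rule bij_betw_imageI)
    show "inj_on \<phi> (nodes P)"
    proof (rule inj_onI)
      fix \<Phi> \<Psi> assume *: "\<Phi> \<in> nodes P" "\<Psi> \<in> nodes P" "\<phi> \<Phi> = \<phi> \<Psi>"
      then have "g (copy k \<Phi> 0) = g (copy k \<Psi> 0)" by (simp add: layer)
      moreover have "inj_on g (nodes Q)" using assms by (simp add: mem_Aut_iff bij_betw_def)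
      ultimately have "copy k \<Phi> 0 = copy k \<Psi> 0" using * by (simp add: inj_on_eq_iff)
      then show "\<Phi> = \<Psi>" by (simp add: copy_eq_iff)
    qed
    \<comment> \<open>The image contains \<open>\<phi> \<Phi>\<^sub>0\<close> and is closed under
      neighbours, so connectedness makes it everything. Injectivity alone would not suffice, as
      \<open>P\<close> may be infinite.\<close>
    have "\<Psi> \<in> \<phi> ` nodes P" if "\<Psi> \<in> nodes P" for \<Psi>
      using pm conn closed[OF \<Phi>\<^sub>0] _ _ that
    proof (rule connected_induct)
      show "nbr P c \<Psi> \<in> \<phi> ` nodes P" if "\<Psi> \<in> \<phi> ` nodes P" "c < n" for \<Psi> c
        using that by (auto simp: nbr_P simp flip: comm)
    qed (use \<Phi>\<^sub>0 in simp)
    then show "\<phi> ` nodes P = nodes P" using closed by blast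
  qed
  then have \<phi>: "\<phi> \<in> carrier (Aut P)"
    by (simp add: mem_Aut_iff_nbr[OF pm] comm) (simp add: \<phi>_def)
  obtain s where s: "compatible \<phi> s t" by (rule ex_compatible)
  have "g = layer_map \<phi> s t"
    using pm_Q connected_Q assms layer_map_Aut[OF \<phi> s]
  proof (rule Aut_eqI)
    show "copy k \<Phi>\<^sub>0 0 \<in> nodes Q" using \<Phi>\<^sub>0 by simp
    show "g (copy k \<Phi>\<^sub>0 0) = layer_map \<phi> s t (copy k \<Phi>\<^sub>0 0)" using \<Phi>\<^sub>0 by (simp add: layer layer_map_copy)
  qed
  with \<phi> s show ?thesis by (rule that)
qed

text \<open>A facet is a whole layer \<open>i\<close>, and \<Phi> \<mapsto>
  \<open>copy k \<Phi> i\<close> is an isomorphism from \<open>P\<close> onto it, so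
  \<open>f\<close> is an automorphism \<phi> of \<open>P\<close> transported to that layer.\<close>

lemma hereditary_Q: "hereditary (n + 1) Q"
  unfolding hereditary_def facets_def faces_def
proof (intro ballI)
  fix F f assume "F \<in> face_at (n + 1 - 1) Q ` nodes Q" and f: "f \<in> carrier (Aut F)"
  then obtain \<Phi>\<^sub>0 i where \<Phi>\<^sub>0: "\<Phi>\<^sub>0 \<in> nodes P" and F: "F = face_at n Q (copy k \<Phi>\<^sub>0 i)"
    by (auto elim!: nodes_Q_cases)
  have nodes_F: "nodes F = {copy k \<Phi> i | \<Phi>. \<Phi> \<in> nodes P}"
  proof (intro equalityI subsetI)
    fix y assume "y \<in> nodes F"
    then have y: "y \<in> nodes Q" "path_using Q (- {n}) (copy k \<Phi>\<^sub>0 i) y"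
      by (simp_all add: F nodes_face_at)
    then obtain \<Psi> j where \<Psi>: "y = copy k \<Psi> j" "\<Psi> \<in> nodes P" by (auto elim: nodes_Q_cases)
    have "snd y = snd (copy k \<Phi>\<^sub>0 i)" using path_project(2)[OF y(2)] \<Phi>\<^sub>0 by simp
    then have "y = copy k \<Psi> i" using \<Psi> by (simp add: copy_def)
    then show "y \<in> {copy k \<Phi> i | \<Phi>. \<Phi> \<in> nodes P}" using \<Psi> by blast
  next
    fix y assume "y \<in> {copy k \<Phi> i | \<Phi>. \<Phi> \<in> nodes P}"
    then obtain \<Phi> where y: "y = copy k \<Phi> i" "\<Phi> \<in> nodes P" by blast
    from pm path_P[OF \<Phi>\<^sub>0 y(2)] \<Phi>\<^sub>0
    have "\<Phi> \<in> nodes P \<and> path_using P (- {n}) \<Phi>\<^sub>0 \<Phi>"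
    proof (rule path_using_induct)
      fix \<Phi> c assume *: "\<Phi> \<in> nodes P" "c < n" "path_using P (- {n}) \<Phi>\<^sub>0 \<Phi>"
      then have "path_using P (- {n}) \<Phi> (nbr P c \<Phi>)" by (intro path_using_nbr[OF pm]) auto
      then show "path_using P (- {n}) \<Phi>\<^sub>0 (nbr P c \<Phi>)" by (rule path_using_trans[OF *(3)])
    qed (rule path_using_refl)
    then show "y \<in> nodes F" using y \<Phi>\<^sub>0 by (simp add: F nodes_face_at path_lift)
  qed
  have edges_F: "(c, {copy k \<Phi> i, copy k \<Psi> i}) \<in> edges F \<longleftrightarrow> (c, {\<Phi>, \<Psi>}) \<in> edges P"
    if "\<Phi> \<in> nodes P" "\<Psi> \<in> nodes P" for c \<Phi> \<Psi>
  proof -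
    have "(c, {copy k \<Phi> i, copy k \<Psi> i}) \<in> edges F \<longleftrightarrow>
        c \<noteq> n \<and> (c, {copy k \<Phi> i, copy k \<Psi> i}) \<in> edges Q"
      using edges_face_at[of n Q "copy k \<Phi>\<^sub>0 i"] that nodes_F by (auto simp: F)
    also have "\<dots> \<longleftrightarrow> c < n \<and> copy k \<Psi> i = nbr Q c (copy k \<Phi> i)"
      using that by (auto simp: edge_iff_nbr[OF pm_Q])
    also have "\<dots> \<longleftrightarrow> (c, {\<Phi>, \<Psi>}) \<in> edges P"
      using that by (auto simp: edge_iff_nbr[OF pm] nbr_Q_less copy_eq_iff)
    finally show ?thesis .
  qed
  define \<phi> where "\<phi> = (\<lambda>\<Phi>\<in>nodes P. fst (f (copy k \<Phi> i)))"
  have \<phi>: "\<phi> \<Phi> \<in> nodes P \<and> f (copy k \<Phi> i) = copy k (\<phi> \<Phi>) i" if "\<Phi> \<in> nodes P" for \<Phi>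
  proof -
    have "f (copy k \<Phi> i) \<in> nodes F" using Aut_closed[OF f] that nodes_F by blast
    then obtain \<Psi> where "f (copy k \<Phi> i) = copy k \<Psi> i" "\<Psi> \<in> nodes P" using nodes_F by blast
    then show ?thesis using that by (simp add: \<phi>_def)
  qed
  have bij_f: "bij_betw f (nodes F) (nodes F)"
    and edges_f: "\<And>c u v. u \<in> nodes F \<Longrightarrow> v \<in> nodes F \<Longrightarrow> (c, {u, v}) \<in> edges F \<longleftrightarrow> (c, {f u, f v}) \<in> edges F"
    using f by (simp_all add: mem_Aut_iff)
  have mem_F: "copy k \<Phi> i \<in> nodes F" if "\<Phi> \<in> nodes P" for \<Phi>
    using that nodes_F by blast
  have "bij_betw \<phi> (nodes P) (nodes P)"
  proof (rule bij_betw_imageI)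
    show "inj_on \<phi> (nodes P)"
    proof (rule inj_onI)
      fix \<Phi> \<Psi> assume *: "\<Phi> \<in> nodes P" "\<Psi> \<in> nodes P" "\<phi> \<Phi> = \<phi> \<Psi>"
      then have "f (copy k \<Phi> i) = f (copy k \<Psi> i)" using \<phi> by simp
      then have "copy k \<Phi> i = copy k \<Psi> i"
        using inj_onD[OF bij_betw_imp_inj_on[OF bij_f]] mem_F[OF *(1)] mem_F[OF *(2)] by blast
      then show "\<Phi> = \<Psi>" by (simp add: copy_eq_iff)
    qed
    have "\<Psi> \<in> \<phi> ` nodes P" if \<Psi>: "\<Psi> \<in> nodes P" for \<Psi>
    proof -
      obtain y where "y \<in> nodes F" "f y = copy k \<Psi> i"
        using mem_F[OF \<Psi>] bij_f unfolding bij_betw_def by (metis imageE)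
      then obtain \<Phi> where "\<Phi> \<in> nodes P" "f (copy k \<Phi> i) = copy k \<Psi> i" by (auto simp: nodes_F)
      then have "\<Psi> = \<phi> \<Phi>" using \<phi> by (simp add: copy_eq_iff)
      then show ?thesis using \<open>\<Phi> \<in> nodes P\<close> by blast
    qed
    then show "\<phi> ` nodes P = nodes P" using \<phi> by blast
  qed
  moreover have "(c, {\<Phi>, \<Psi>}) \<in> edges P \<longleftrightarrow> (c, {\<phi> \<Phi>, \<phi> \<Psi>}) \<in> edges P"
    if "\<Phi> \<in> nodes P" "\<Psi> \<in> nodes P" for c \<Phi> \<Psi>
    using edges_f[OF mem_F[OF that(1)] mem_F[OF that(2)], of c] that \<phi> edges_F by simp
  ultimately have \<phi>_Aut: "\<phi> \<in> carrier (Aut P)"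
    by (simp add: mem_Aut_iff) (simp add: \<phi>_def)
  \<comment> \<open>Layer \<open>i\<close> has to be fixed, so \<open>t\<close> is 0 for the trivial
    sign and 2 i for the reflection; both are even, as compatibility demands. The lift of a
    reversing \<phi> reflects about layer 1 and need not fix layer \<open>i\<close>.\<close>
  define s t where "s = (if preserving \<phi> then 1 else - 1 :: int)" and "t = i - s * i"
  have "compatible \<phi> s t" by (auto simp: compatible_def s_def t_def)
  from layer_map_Aut[OF \<phi>_Aut this]
  show "\<exists>g\<in>carrier (Aut Q). \<forall>\<Phi>\<in>nodes F. g \<Phi> = f \<Phi>"
    using \<phi> by (intro bexI[of _ "layer_map \<phi> s t"]) (auto simp: nodes_F layer_map_copy t_def)
qed

text \<open>Read off from the function itself, because different triples (\<phi>, s, t) may describe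
  the same automorphism.\<close>

definition proj :: "('a \<times> int \<Rightarrow> 'a \<times> int) \<Rightarrow> 'a \<Rightarrow> 'a" where
  "proj g = (\<lambda>\<Phi>\<in>nodes P. fst (g (copy k \<Phi> 0)))"

lemma proj_layer_map: "\<phi> \<in> carrier (Aut P) \<Longrightarrow> proj (layer_map \<phi> s t) = \<phi>"
  by (rule extensionalityI[of _ "nodes P"]) (simp_all add: proj_def layer_map_copy mem_Aut_iff)

lemma proj_closed: "g \<in> carrier (Aut Q) \<Longrightarrow> proj g \<in> carrier (Aut P)"
  by (auto elim!: Aut_Q_cases simp: proj_layer_map)

lemma proj_hom: "proj \<in> hom (Aut Q) (Aut P)"
proof (rule homI)
  fix g h assume gh: "g \<in> carrier (Aut Q)" "h \<in> carrier (Aut Q)"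
  obtain \<phi> s t where "\<phi> \<in> carrier (Aut P)" "g = layer_map \<phi> s t" using gh(1) by (rule Aut_Q_cases)
  moreover obtain \<psi> s' t' where "\<psi> \<in> carrier (Aut P)" "h = layer_map \<psi> s' t'"
    using gh(2) by (rule Aut_Q_cases)
  ultimately show "proj (g \<otimes>\<^bsub>Aut Q\<^esub> h) = proj g \<otimes>\<^bsub>Aut P\<^esub> proj h"
    by (simp add: mult_layer_map proj_layer_map)
qed (rule proj_closed)

lemma compatible_lift: "compatible \<phi> 1 0 \<longleftrightarrow> preserving \<phi>"
  "compatible \<phi> (- 1) (int k + 2) \<longleftrightarrow> \<not> preserving \<phi>"
  using k_even by (auto simp: compatible_def)

text \<open>All reversing automorphisms use the same reflection of the layers, an involution, so the
  lifts of two of them multiply to a map fixing every layer.\<close>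

lemma lift_hom: "lift_aut n P col k \<in> hom (Aut P) (Aut Q)"
proof (rule homI)
  show "lift_aut n P col k \<phi> \<in> carrier (Aut Q)" if "\<phi> \<in> carrier (Aut P)" for \<phi>
    using that by (simp add: lift_eq layer_map_Aut compatible_lift)
  fix \<phi> \<psi> assume *: "\<phi> \<in> carrier (Aut P)" "\<psi> \<in> carrier (Aut P)"
  then show "lift_aut n P col k (\<phi> \<otimes>\<^bsub>Aut P\<^esub> \<psi>) = lift_aut n P col k \<phi> \<otimes>\<^bsub>Aut Q\<^esub> lift_aut n P col k \<psi>"
    by (simp add: lift_eq mult_layer_map preserving_mult)
qed

lemma proj_lift: "\<forall>\<phi>\<in>carrier (Aut P). proj (lift_aut n P col k \<phi>) = \<phi>"
  by (simp add: lift_eq proj_layer_map)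

text \<open>Applying \<alpha> and then \<beta> shifts subscripts by (k + 5) - (k + 3) = 2, so the
  even rotations are powers of this product. A reflection with odd t is \<alpha> followed by the
  rotation by t - (k + 3), which is even.\<close>

lemma kernel_proj: "kernel (Aut Q) (Aut P) proj = generate (Aut Q) {layer_alpha n P col k, layer_beta n P col k}"
    (is "?K = generate _ {?\<alpha>, ?\<beta>}")
proof
  let ?id = "\<one>\<^bsub>Aut P\<^esub>" and ?N = "generate (Aut Q) {?\<alpha>, ?\<beta>}"
  have ab: "?\<alpha> \<in> carrier (Aut Q)" "?\<beta> \<in> carrier (Aut Q)"
    using k_even by (simp_all add: alpha_eq beta_eq layer_map_Aut compatible_def preserving_one)
  interpret group_hom "Aut Q" "Aut P" proj
    by (simp add: group_hom_def group_hom_axioms_def group_Aut proj_hom)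
  have "{?\<alpha>, ?\<beta>} \<subseteq> ?K"
    using ab by (auto simp: kernel_def alpha_eq beta_eq proj_layer_map)
  then show "?N \<subseteq> ?K"
    by (rule G.generate_subgroup_incl) (rule subgroup_kernel)
  have period: "layer_map ?id s (t + int k * m) = layer_map ?id s t" for s t m
    by (simp add: layer_map_def copy_def flip: add.assoc)
  have rotation: "layer_map ?id 1 (2 * int m) \<in> ?N" for m
  proof (induction m)
    case 0
    have "\<one>\<^bsub>Aut Q\<^esub> = layer_map ?id 1 0"
      by (rule eq_layer_mapI) (simp_all add: one_Aut)
    then show ?case using generate.one[of "Aut Q" "{?\<alpha>, ?\<beta>}"] by simp
  next
    case (Suc m)
    have "layer_map ?id 1 (2 * int (Suc m)) = layer_map ?id 1 (2 * int m) \<otimes>\<^bsub>Aut Q\<^esub> (?\<alpha> \<otimes>\<^bsub>Aut Q\<^esub> ?\<beta>)"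
      by (simp add: alpha_eq beta_eq mult_layer_map add.commute)
    then show ?case
      using Suc by (auto intro!: generate.eng intro: generate.incl)
  qed
  have even: "layer_map ?id 1 t \<in> ?N" if "even t" for t
  proof -
    \<comment> \<open>Reduction modulo the even \<open>k\<close> keeps \<open>t\<close> even and
      makes it nonnegative, so natural powers are enough.\<close>
    have "even (t mod int k)"
      by (rule dvd_mod[OF that even_int_k])
    then obtain m where m: "t mod int k = 2 * m" by (auto elim: evenE)
    moreover have "t mod int k \<ge> 0" using k_pos by simp
    ultimately have "t mod int k = 2 * int (nat m)" by simp
    moreover have "layer_map ?id 1 t = layer_map ?id 1 (t mod int k)"
      using period[of 1 "t mod int k" "t div int k"] by simp
    ultimately show ?thesis using rotation[of "nat m"] by simp
  qed
  show "?K \<subseteq> ?N"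
  proof
    fix g assume "g \<in> ?K"
    then have g: "g \<in> carrier (Aut Q)" "proj g = ?id" by (simp_all add: kernel_def)
    obtain \<phi> s t where \<phi>: "\<phi> \<in> carrier (Aut P)" "compatible \<phi> s t" "g = layer_map \<phi> s t"
      using g(1) by (rule Aut_Q_cases)
    then have id: "\<phi> = ?id" using g(2) by (simp add: proj_layer_map)
    then have "s = 1 \<and> even t \<or> s = - 1 \<and> odd t"
      using \<phi>(2) by (auto simp: compatible_def preserving_one)
    then show "g \<in> ?N"
    proof (elim disjE conjE)
      assume "s = 1" "even t"
      then show ?thesis using even \<phi>(3) id by simp
    next
      assume s: "s = - 1" "odd t"
      have "g = ?\<alpha> \<otimes>\<^bsub>Aut Q\<^esub> layer_map ?id 1 (t - (int k + 3))"
        by (simp add: \<phi>(3) id s(1) alpha_eq mult_layer_map)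
      moreover have "layer_map ?id 1 (t - (int k + 3)) \<in> ?N" using s k_even by (intro even) simp
      ultimately show ?thesis by (auto intro!: generate.eng intro: generate.incl)
    qed
  qed
qed

lemmas split_Q = split_extension[where p = proj and l = "lift_aut n P col k",
  OF group_Aut group_Aut proj_hom lift_hom proj_lift, unfolded kernel_proj]

section \<open>Flag orbits and the symmetry type graph\<close>

lemma flag_orbit_Q_iff:
  assumes "\<Phi> \<in> nodes P" "\<Psi> \<in> nodes P"
  shows "flag_orbit Q (copy k \<Phi> i) = flag_orbit Q (copy k \<Psi> j) \<longleftrightarrow> flag_orbit P \<Phi> = flag_orbit P \<Psi>"
proof -
  have "(\<exists>g\<in>carrier (Aut Q). g (copy k \<Phi> i) = copy k \<Psi> j) \<longleftrightarrow> (\<exists>\<phi>\<in>carrier (Aut P). \<phi> \<Phi> = \<Psi>)"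
  proof
    assume "\<exists>g\<in>carrier (Aut Q). g (copy k \<Phi> i) = copy k \<Psi> j"
    then obtain g where g: "g \<in> carrier (Aut Q)" "g (copy k \<Phi> i) = copy k \<Psi> j" by blast
    obtain \<phi> s t where "\<phi> \<in> carrier (Aut P)" "g = layer_map \<phi> s t" using g(1) by (rule Aut_Q_cases)
    then show "\<exists>\<phi>\<in>carrier (Aut P). \<phi> \<Phi> = \<Psi>" using g(2) assms by (auto simp: layer_map_copy copy_eq_iff)
  next
    assume "\<exists>\<phi>\<in>carrier (Aut P). \<phi> \<Phi> = \<Psi>"
    then obtain \<phi> where \<phi>: "\<phi> \<in> carrier (Aut P)" "\<phi> \<Phi> = \<Psi>" by blast
    \<comment> \<open>The translation \<open>j - s * i\<close> has the parity of
      \<open>j - i\<close> for either sign, so this parity and \<phi> dictate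
      \<open>s\<close>.\<close>
    define s where "s = (if even (j - i) \<longleftrightarrow> preserving \<phi> then 1 else - 1 :: int)"
    have "compatible \<phi> s (j - s * i)" by (auto simp: compatible_def s_def)
    then show "\<exists>g\<in>carrier (Aut Q). g (copy k \<Phi> i) = copy k \<Psi> j"
      using assms \<phi> by (intro bexI[of _ "layer_map \<phi> s (j - s * i)"] layer_map_Aut) (auto simp: layer_map_copy)
  qed
  then show ?thesis using assms by (simp add: flag_orbit_eq_iff)
qed

lemma regular_Q_iff: "regular Q \<longleftrightarrow> regular P"
proof
  assume "regular Q"
  then show "regular P"
    using flag_orbit_Q_iff[of _ _ 0 0] unfolding regular_def
    by (simp add: flag_orbit_eq_iff)
next
  assume "regular P"
  then have orb: "flag_orbit P \<Phi> = flag_orbit P \<Psi>" if "\<Phi> \<in> nodes P" "\<Psi> \<in> nodes P" for \<Phi> \<Psi>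
    using that by (simp add: flag_orbit_eq_iff regular_def)
  have "flag_orbit Q x = flag_orbit Q y" if "x \<in> nodes Q" "y \<in> nodes Q" for x y
  proof -
    obtain \<Phi> i where x: "x = copy k \<Phi> i" "\<Phi> \<in> nodes P" using \<open>x \<in> nodes Q\<close> by (rule nodes_Q_cases)
    obtain \<Psi> j where y: "y = copy k \<Psi> j" "\<Psi> \<in> nodes P" using \<open>y \<in> nodes Q\<close> by (rule nodes_Q_cases)
    show ?thesis using orb[OF x(2) y(2)] x y by (simp add: flag_orbit_Q_iff)
  qed
  then show "regular Q" by (simp add: regular_def flag_orbit_eq_iff)
qed

text \<open>Every orbit of \<open>P|k\<close> meets every layer, so it is captured by its flags of
  \<open>P\<close>. Forgetting the layer is thus the node map of the isomorphism between the
  symmetry type graphs.\<close>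

lemma fst_flag_orbit_Q:
  assumes "\<Phi> \<in> nodes P"
  shows "fst ` flag_orbit Q (copy k \<Phi> i) = flag_orbit P \<Phi>"
proof (intro equalityI subsetI)
  fix \<Psi> assume "\<Psi> \<in> fst ` flag_orbit Q (copy k \<Phi> i)"
  then obtain g where g: "g \<in> carrier (Aut Q)" "\<Psi> = fst (g (copy k \<Phi> i))" by (auto simp: orbit_Aut)
  obtain \<phi> s t where "\<phi> \<in> carrier (Aut P)" "g = layer_map \<phi> s t" using g(1) by (rule Aut_Q_cases)
  then show "\<Psi> \<in> flag_orbit P \<Phi>" using g(2) assms by (auto simp: layer_map_copy orbit_Aut)
next
  fix \<Psi> assume "\<Psi> \<in> flag_orbit P \<Phi>"
  then obtain \<phi> where \<phi>: "\<phi> \<in> carrier (Aut P)" "\<Psi> = \<phi> \<Phi>" by (auto simp: orbit_Aut)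
  then have \<Psi>: "\<Psi> \<in> nodes P" using assms by (simp add: Aut_closed)
  have "flag_orbit P \<Phi> = flag_orbit P \<Psi>"
    using flag_orbit_eq[OF \<phi>(1) assms] \<phi>(2) by simp
  then have "copy k \<Psi> 0 \<in> flag_orbit Q (copy k \<Phi> i)"
    using flag_orbit_Q_iff[OF assms \<Psi>, of i 0] mem_flag_orbit_refl[of "copy k \<Psi> 0" Q] \<Psi> by simp
  then show "\<Psi> \<in> fst ` flag_orbit Q (copy k \<Phi> i)" by force
qed

lemma symmetry_type_graph_Q:
  "isomorphic_cgraphs (symmetry_type_graph (n + 1) Q) (add_semi_edges n (symmetry_type_graph n P))"
proof -
  let ?S = "symmetry_type_graph (n + 1) Q" and ?T = "add_semi_edges n (symmetry_type_graph n P)"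
  have nodes_S: "nodes ?S = (\<lambda>\<Phi>. flag_orbit Q (copy k \<Phi> 0)) ` nodes P"
  proof -
    have "flag_orbit Q (copy k \<Phi> i) = flag_orbit Q (copy k \<Phi> 0)" if "\<Phi> \<in> nodes P" for \<Phi> i
      using that by (simp add: flag_orbit_Q_iff)
    then have "(\<exists>x\<in>nodes Q. u = flag_orbit Q x) \<longleftrightarrow> (\<exists>\<Phi>\<in>nodes P. u = flag_orbit Q (copy k \<Phi> 0))" for u
      unfolding bex_nodes_Q by metis
    then show ?thesis by (simp add: nodes_symmetry_type_graph image_def)
  qed
  have nodes_T: "nodes ?T = flag_orbit P ` nodes P"
    by (simp add: add_semi_edges_def nodes_symmetry_type_graph)
  have edges_S: "(c, {flag_orbit Q (copy k \<Phi> 0), flag_orbit Q (copy k \<Psi> 0)}) \<in> edges ?S \<longleftrightarrow>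
      (c, {flag_orbit P \<Phi>, flag_orbit P \<Psi>}) \<in> edges ?T"
    if "\<Phi> \<in> nodes P" "\<Psi> \<in> nodes P" for c \<Phi> \<Psi>
  proof -
    have "(c, {flag_orbit Q (copy k \<Phi> 0), flag_orbit Q (copy k \<Psi> 0)}) \<in> edges ?S \<longleftrightarrow>
      c < n + 1 \<and> (\<exists>\<Lambda> i. \<Lambda> \<in> nodes P \<and> {flag_orbit Q (copy k \<Phi> 0), flag_orbit Q (copy k \<Psi> 0)}
         = {flag_orbit Q (copy k \<Lambda> i), flag_orbit Q (nbr Q c (copy k \<Lambda> i))})"
      by (simp only: mem_edges_symmetry_type_graph bex_nodes_Q)
    \<comment> \<open>In colour \<open>n\<close> the neighbour is the same flag in an adjacent
      layer, hence in the same orbit, and the pair of orbits collapses to a singleton, which encodes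
      a semi-edge.\<close>
    also have "\<dots> \<longleftrightarrow> c < n + 1 \<and> (\<exists>\<Lambda>\<in>nodes P. {flag_orbit P \<Phi>, flag_orbit P \<Psi>}
         = {flag_orbit P \<Lambda>, flag_orbit P (if c < n then nbr P c \<Lambda> else \<Lambda>)})"
    proof -
      have eq: "{flag_orbit Q (copy k \<Phi> 0), flag_orbit Q (copy k \<Psi> 0)}
         = {flag_orbit Q (copy k \<Lambda> i), flag_orbit Q (nbr Q c (copy k \<Lambda> i))} \<longleftrightarrow>
         {flag_orbit P \<Phi>, flag_orbit P \<Psi>} = {flag_orbit P \<Lambda>, flag_orbit P (if c < n then nbr P c \<Lambda> else \<Lambda>)}"
        if "\<Lambda> \<in> nodes P" "c < n + 1" for \<Lambda> i
      proof -
        have "nbr Q c (copy k \<Lambda> i) = copy k (if c < n then nbr P c \<Lambda> else \<Lambda>) (if c < n then i else i + dir \<Lambda> i)"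
          using that by (simp add: nbr_Q step_copy)
        moreover have "(if c < n then nbr P c \<Lambda> else \<Lambda>) \<in> nodes P" using that by (simp add: nbr_P)
        ultimately show ?thesis
          using \<open>\<Phi> \<in> nodes P\<close> \<open>\<Psi> \<in> nodes P\<close> \<open>\<Lambda> \<in> nodes P\<close>
          by (simp only: doubleton_eq_iff flag_orbit_Q_iff)
      qed
      show ?thesis by (simp only: eq Bex_def simp_thms cong: conj_cong)
    qed
    also have "\<dots> \<longleftrightarrow> (c, {flag_orbit P \<Phi>, flag_orbit P \<Psi>}) \<in> edges ?T"
    proof (cases "c < n")
      case True
      then show ?thesis
        by (auto simp: add_semi_edges_def mem_edges_symmetry_type_graph)
    next
      case False
      then show ?thesis
        by (auto simp: add_semi_edges_def mem_edges_symmetry_type_graph nodes_symmetry_type_graph)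
    qed
    finally show ?thesis .
  qed
  have "(\<lambda>u. fst ` u) \<in> cgraph_iso ?S ?T"
    unfolding cgraph_iso_def
  proof (intro CollectI conjI allI ballI)
    show "bij_betw (\<lambda>u. fst ` u) (nodes ?S) (nodes ?T)"
    proof (rule bij_betw_imageI)
      show "inj_on (\<lambda>u. fst ` u) (nodes ?S)"
        unfolding nodes_S
        by (intro inj_onI) (elim imageE, simp only: fst_flag_orbit_Q flag_orbit_Q_iff)
      show "(\<lambda>u. fst ` u) ` nodes ?S = nodes ?T"
        unfolding nodes_S nodes_T image_image by (intro image_cong refl fst_flag_orbit_Q)
    qed
    fix c u v assume "u \<in> nodes ?S" "v \<in> nodes ?S"
    then obtain \<Phi> \<Psi> where "u = flag_orbit Q (copy k \<Phi> 0)" "v = flag_orbit Q (copy k \<Psi> 0)"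
      "\<Phi> \<in> nodes P" "\<Psi> \<in> nodes P"
      unfolding nodes_S by blast
    then show "(c, {u, v}) \<in> edges ?S \<longleftrightarrow> (c, {fst ` u, fst ` v}) \<in> edges ?T"
      by (simp only: fst_flag_orbit_Q edges_S)
  qed
  then show ?thesis by (auto simp: isomorphic_cgraphs_def)
qed

end

theorem proposition3p9:
  fixes n k :: nat
    and P :: "'a cgraph"
    and col :: "'a cgraph \<Rightarrow> red_blue"
  assumes "n \<ge> 1"
    and "polytope n P"
    and "facet_bipartite n P"
    and "proper_facet_coloring n P col"
    and "k > 0" and "even k"
  defines "Q \<equiv> layered n P col k"
    and "\<alpha> \<equiv> layer_alpha n P col k"
    and "\<beta> \<equiv> layer_beta n P col k"
    and "lift \<equiv> lift_aut n P col k"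
  defines "N \<equiv> generate (Aut Q) {\<alpha>, \<beta>}"
  defines "H \<equiv> lift ` carrier (Aut P)"
  shows "polytope (n + 1) Q \<and>
    hereditary (n + 1) Q \<and>
    (N \<lhd> Aut Q \<and>
     subgroup H (Aut Q) \<and>
     lift \<in> iso (Aut P) (Aut Q\<lparr>carrier := H\<rparr>) \<and>
     (\<lambda>(\<phi>, \<gamma>). lift \<phi> \<otimes>\<^bsub>Aut Q\<^esub> \<gamma>) \<in>
       iso (semidirect_product (Aut P) (Aut Q\<lparr>carrier := N\<rparr>)
              (\<lambda>\<phi> \<gamma>. inv\<^bsub>Aut Q\<^esub> (lift \<phi>) \<otimes>\<^bsub>Aut Q\<^esub> \<gamma> \<otimes>\<^bsub>Aut Q\<^esub> lift \<phi>))
           (Aut Q)) \<and>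
    (isomorphic_cgraphs (symmetry_type_graph (n + 1) Q)
       (add_semi_edges n (symmetry_type_graph n P)) \<and>
     (regular Q \<longleftrightarrow> regular P))"
proof -
  interpret layering n k P col
    using assms by unfold_locales
  show ?thesis
    unfolding H_def N_def Q_def \<alpha>_def \<beta>_def lift_def
    using polytope_Q hereditary_Q split_Q symmetry_type_graph_Q regular_Q_iff by blast
qed

end
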